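(* Let $T$ be a left Artinian ring which is integral over its center. Then either $T$ has a maximal subring, or $T$ is countable, has nonzero characteristic, and is integral over its prime subring $\{n\cdot 1_T: n\in\mathbb{Z}\}$.
   Context: All rings are associative with identity $1\neq0$; subrings contain the identity. A maximal subring of $T$ is a proper subring with no subring strictly between it and $T$. $T$ is integral over its center $C(T)$ (resp. over a central subring $S$) if every element of $T$ is a root of a monic polynomial with coefficients in $C(T)$ (resp. in $S$). *)

theory Defs
  imports Main "HOL-Library.Countable_Set"
begin

definition is_subring :: "'a::ring_1 set \<Rightarrow> bool" where
  "is_subring S \<longleftrightarrow> 1 \<in> S \<and> (\<forall>x\<in>S. \<forall>y\<in>S. x - y \<in> S \<and> x * y \<in> S)"

definition maximal_subring :: "'a::ring_1 set \<Rightarrow> bool" where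
  "maximal_subring S \<longleftrightarrow> is_subring S \<and> S \<noteq> UNIV \<and>
     (\<forall>R. is_subring R \<and> S \<subseteq> R \<longrightarrow> R = S \<or> R = UNIV)"

definition has_maximal_subring :: "'a::ring_1 itself \<Rightarrow> bool" where
  "has_maximal_subring _ \<longleftrightarrow> (\<exists>S::'a set. maximal_subring S)"

definition ring_center :: "'a::ring_1 set" where
  "ring_center = {c. \<forall>x. c * x = x * c}"

definition left_ideal :: "'a::ring_1 set \<Rightarrow> bool" where
  "left_ideal I \<longleftrightarrow> 0 \<in> I \<and> (\<forall>x\<in>I. \<forall>y\<in>I. x - y \<in> I) \<and> (\<forall>r. \<forall>x\<in>I. r * x \<in> I)"

definition left_artinian :: "'a::ring_1 itself \<Rightarrow> bool" where
  "left_artinian _ \<longleftrightarrow> (\<forall>f :: nat \<Rightarrow> 'a set.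
     (\<forall>n. left_ideal (f n)) \<and> (\<forall>n. f (Suc n) \<subseteq> f n) \<longrightarrow> (\<exists>N. \<forall>n\<ge>N. f n = f N))"

text \<open>x is integral over S: root of a monic polynomial with coefficients in S
  (coefficients written on the left; S will be central).\<close>
definition integral_over :: "'a::ring_1 set \<Rightarrow> 'a \<Rightarrow> bool" where
  "integral_over S x \<longleftrightarrow> (\<exists>n::nat. \<exists>c::nat \<Rightarrow> 'a. n \<ge> 1 \<and> (\<forall>i<n. c i \<in> S) \<and>
      x ^ n + (\<Sum>i<n. c i * x ^ i) = 0)"

definition ring_integral_over :: "'a::ring_1 set \<Rightarrow> bool" where
  "ring_integral_over S \<longleftrightarrow> (\<forall>x::'a. integral_over S x)"

definition prime_subring :: "'a::ring_1 set" where
  "prime_subring = range (of_int :: int \<Rightarrow> 'a)"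

definition nonzero_char :: "'a::ring_1 itself \<Rightarrow> bool" where
  "nonzero_char _ \<longleftrightarrow> (\<exists>n::nat. n > 0 \<and> (of_nat n :: 'a) = 0)"

end

theory Submission
  imports Defs "HOL-Computational_Algebra.Polynomial"
begin

text \<open>
  Suppose that \<open>T\<close> has no maximal subring. By Zorn's lemma no proper subring can generate \<open>T\<close>
  together with finitely many elements. If a maximal left ideal \<open>M\<close> were not two-sided, then
  \<open>\<int> + M\<close> would be such a subring, as \<open>T = M + My\<close> for some \<open>y\<close>. If \<open>T/M\<close> were not commutative,
  the centralizer modulo \<open>M\<close> of a noncentral element \<open>a\<close> would be another one, as \<open>T/M\<close> has finite
  dimension over it. If the field \<open>T/M\<close> were not algebraic over a finite field, it would be algebraic
  over a polynomial ring \<open>K[x]\<close>, or over \<open>\<int>\<close> with \<open>x = 2\<close>, and a subring maximal without \<open>1/x\<close>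
  would be a maximal subring.

  Hence each \<open>T/M\<close> is countable, of nonzero characteristic and integral over the prime subring.
  Let \<open>L\<close> be a minimal left ideal among those modulo which \<open>T\<close> has these properties. Minimality
  gives \<open>M L = L\<close> for all \<open>M\<close>, and a minimal left ideal \<open>K\<close> with \<open>K L = L\<close> is
  idempotent and contained in every \<open>M\<close>. As for the Jacobson radical of an Artinian ring, this
  forces \<open>K = 0\<close>, so \<open>L = 0\<close>.
\<close>

section \<open>Left ideals and subrings\<close>

lemma left_idealD:
  assumes "left_ideal I"
  shows left_ideal_zero: "0 \<in> I"
    and left_ideal_diff: "\<And>x y. x \<in> I \<Longrightarrow> y \<in> I \<Longrightarrow> x - y \<in> I"
    and left_ideal_mult: "\<And>r x. x \<in> I \<Longrightarrow> r * x \<in> I"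
  using assms by (auto simp: left_ideal_def)

lemma left_ideal_uminus:
  assumes "left_ideal I" "x \<in> I" shows "- x \<in> I"
  using left_ideal_diff[OF assms(1) left_ideal_zero[OF assms(1)] assms(2)] by simp

lemma left_ideal_add:
  assumes "left_ideal I" "x \<in> I" "y \<in> I" shows "x + y \<in> I"
  using left_ideal_diff[OF assms(1,2) left_ideal_uminus[OF assms(1,3)]] by simp

lemma left_ideal_sum:
  assumes "left_ideal I" "\<And>j. j \<in> J \<Longrightarrow> f j \<in> I"
  shows "sum f J \<in> I"
  using assms(2) by (induction J rule: infinite_finite_induct)
    (auto simp: left_ideal_zero[OF assms(1)] intro!: left_ideal_add[OF assms(1)])

lemma left_ideal_UNIV: "left_ideal UNIV"
  by (simp add: left_ideal_def)

lemma left_ideal_eq_UNIV: "left_ideal I \<Longrightarrow> 1 \<in> I \<Longrightarrow> I = UNIV"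
  unfolding left_ideal_def by (metis UNIV_eq_I mult.right_neutral)

lemma Union_chain_common:
  assumes "subset.chain A \<C>" "x \<in> \<Union>\<C>" "y \<in> \<Union>\<C>"
  obtains S where "S \<in> \<C>" "x \<in> S" "y \<in> S"
proof -
  obtain S T where ST: "S \<in> \<C>" "x \<in> S" "T \<in> \<C>" "y \<in> T"
    using assms(2,3) by blast
  then have "S \<subseteq> T \<or> T \<subseteq> S"
    using assms(1) unfolding subset_chain_def by blast
  then show ?thesis
    using ST that by blast
qed

lemma left_ideal_Union_chain:
  assumes "\<C> \<noteq> {}" "subset.chain A \<C>" "\<And>I. I \<in> A \<Longrightarrow> left_ideal I"
  shows "left_ideal (\<Union>\<C>)"
proof -
  have l: "left_ideal I" if "I \<in> \<C>" for I
    using assms(2,3) that unfolding subset_chain_def by blast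
  show ?thesis
    unfolding left_ideal_def
  proof (intro conjI ballI allI)
    show "0 \<in> \<Union>\<C>"
      using assms(1) l left_ideal_zero by blast
    show "r * x \<in> \<Union>\<C>" if "x \<in> \<Union>\<C>" for r x
      using that l left_ideal_mult by blast
    fix x y assume "x \<in> \<Union>\<C>" "y \<in> \<Union>\<C>"
    then obtain I where "I \<in> \<C>" "x \<in> I" "y \<in> I"
      by (rule Union_chain_common[OF assms(2)])
    then show "x - y \<in> \<Union>\<C>"
      using left_ideal_diff[OF l] by blast
  qed
qed

lemma left_ideal_add_principal:
  assumes I: "left_ideal I" and J: "left_ideal J"
  shows "left_ideal {i + j * v |i j. i \<in> I \<and> j \<in> J}"
  unfolding left_ideal_def
proof (intro conjI ballI allI)
  let ?S = "{i + j * v |i j. i \<in> I \<and> j \<in> J}"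
  have "(0::'a) = 0 + 0 * v" by simp
  then show "0 \<in> ?S"
    using left_ideal_zero[OF I] left_ideal_zero[OF J] by blast
  fix x assume "x \<in> ?S"
  then obtain i r where x: "x = i + r * v" "i \<in> I" "r \<in> J" by blast
  have "s * x = s * i + (s * r) * v" for s
    using x by (simp add: algebra_simps)
  then show "s * x \<in> ?S" for s
    using x left_ideal_mult[OF I] left_ideal_mult[OF J] by blast
  fix y assume "y \<in> ?S"
  then obtain j s where y: "y = j + s * v" "j \<in> I" "s \<in> J" by blast
  have "x - y = (i - j) + (r - s) * v"
    using x y by (simp add: algebra_simps)
  then show "x - y \<in> ?S"
    using x y left_ideal_diff[OF I] left_ideal_diff[OF J] by blast
qed

lemma subset_add_principal:
  assumes "left_ideal J" shows "I \<subseteq> {i + j * v |i j. i \<in> I \<and> j \<in> J}"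
proof
  fix x assume "x \<in> I"
  moreover have "x = x + 0 * v" by simp
  ultimately show "x \<in> {i + j * v |i j. i \<in> I \<and> j \<in> J}"
    using left_ideal_zero[OF assms] by blast
qed

section \<open>Subrings, unions of chains, and extensions by finitely many elements\<close>

lemma subringD:
  assumes "is_subring S"
  shows subring_one: "1 \<in> S"
    and subring_diff: "\<And>x y. x \<in> S \<Longrightarrow> y \<in> S \<Longrightarrow> x - y \<in> S"
    and subring_mult: "\<And>x y. x \<in> S \<Longrightarrow> y \<in> S \<Longrightarrow> x * y \<in> S"
  using assms by (auto simp: is_subring_def)

lemma subring_zero: "is_subring S \<Longrightarrow> 0 \<in> S"
  using subring_diff[of S 1 1] by (simp add: subring_one)

lemma subring_uminus: "is_subring S \<Longrightarrow> x \<in> S \<Longrightarrow> - x \<in> S"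
  using subring_diff[of S 0 x] by (simp add: subring_zero)

lemma subring_add: "is_subring S \<Longrightarrow> x \<in> S \<Longrightarrow> y \<in> S \<Longrightarrow> x + y \<in> S"
  using subring_diff[of S x "- y"] by (simp add: subring_uminus)

lemma subring_power: "is_subring S \<Longrightarrow> x \<in> S \<Longrightarrow> x ^ n \<in> S"
  by (induction n) (auto simp: subring_one subring_mult)

lemma subring_sum:
  assumes "is_subring S" "\<And>j. j \<in> J \<Longrightarrow> f j \<in> S"
  shows "sum f J \<in> S"
  using assms(2) by (induction J rule: infinite_finite_induct)
    (auto simp: subring_zero[OF assms(1)] intro!: subring_add[OF assms(1)])

lemma subring_Union_chain:
  assumes "\<C> \<noteq> {}" "subset.chain A \<C>" "\<And>S. S \<in> A \<Longrightarrow> is_subring S"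
  shows "is_subring (\<Union>\<C>)"
proof -
  have l: "is_subring I" if "I \<in> \<C>" for I
    using assms(2,3) that unfolding subset_chain_def by blast
  show ?thesis
    unfolding is_subring_def
  proof (intro conjI ballI)
    show "1 \<in> \<Union>\<C>"
      using assms(1) l subring_one by blast
    fix x y assume "x \<in> \<Union>\<C>" "y \<in> \<Union>\<C>"
    then obtain S where "S \<in> \<C>" "x \<in> S" "y \<in> S"
      by (rule Union_chain_common[OF assms(2)])
    then show "x - y \<in> \<Union>\<C>" "x * y \<in> \<Union>\<C>"
      using subring_diff[OF l] subring_mult[OF l] by blast+
  qed
qed

text \<open>Zorn's lemma gives a subring \<open>S\<close> maximal among those containing
  \<open>R\<close> but not all of \<open>Y\<close>; any larger subring contains \<open>R\<close> and
  \<open>Y\<close>, hence is everything. Finiteness of \<open>Y\<close> is what lets the condition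
  pass to unions of chains.\<close>

lemma maximal_subring_if_finitely_generated_extension:
  fixes R :: "'a::ring_1 set"
  assumes R: "is_subring R" "R \<noteq> UNIV" and Y: "finite Y"
    and gen: "\<And>S. is_subring S \<Longrightarrow> R \<subseteq> S \<Longrightarrow> Y \<subseteq> S \<Longrightarrow> S = UNIV"
  shows "has_maximal_subring TYPE('a)"
proof -
  let ?A = "{S. is_subring S \<and> R \<subseteq> S \<and> \<not> Y \<subseteq> S}"
  have "\<exists>S\<in>?A. \<forall>X\<in>?A. S \<subseteq> X \<longrightarrow> X = S"
  proof (rule subset_Zorn_nonempty)
    show "?A \<noteq> {}" using R gen[of R] by auto
    fix \<C> assume ne: "\<C> \<noteq> {}" and C: "subset.chain ?A \<C>"
    have s: "is_subring (\<Union>\<C>)"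
      by (rule subring_Union_chain[OF ne C]) auto
    have CA: "\<C> \<subseteq> ?A" using C by (simp add: subset.chain_def)
    have "\<not> Y \<subseteq> \<Union>\<C>"
    proof
      assume "Y \<subseteq> \<Union>\<C>"
      then obtain B where "B \<in> \<C>" "Y \<subseteq> B"
        using finite_subset_Union_chain[OF Y _ ne C] by blast
      then show False using CA by blast
    qed
    moreover have "R \<subseteq> \<Union>\<C>"
      using ne CA by blast
    ultimately show "\<Union>\<C> \<in> ?A" using s by blast
  qed
  then obtain S where S: "S \<in> ?A" and "\<forall>X\<in>?A. S \<subseteq> X \<longrightarrow> X = S" ..
  note max = this(2)[rule_format]
  have "maximal_subring S"
    unfolding maximal_subring_def
  proof (intro conjI allI impI)
    fix X assume X: "is_subring X \<and> S \<subseteq> X"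
    show "X = S \<or> X = UNIV"
    proof (cases "Y \<subseteq> X")
      case True
      then show ?thesis using gen[of X] X S by auto
    next
      case False
      then show ?thesis using max[of X] X S by auto
    qed
  qed (use S in auto)
  then show ?thesis unfolding has_maximal_subring_def by blast
qed

section \<open>Maximal left ideals\<close>

definition maximal_left_ideal :: "'a::ring_1 set \<Rightarrow> bool" where
  "maximal_left_ideal M \<longleftrightarrow> left_ideal M \<and> 1 \<notin> M \<and>
     (\<forall>I. left_ideal I \<and> M \<subseteq> I \<longrightarrow> I = M \<or> I = UNIV)"

lemma maximal_left_ideal_exists:
  assumes I: "left_ideal I" "1 \<notin> I"
  shows "\<exists>M. maximal_left_ideal M \<and> I \<subseteq> M"
proof -
  let ?A = "{J. left_ideal J \<and> I \<subseteq> J \<and> 1 \<notin> J}"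
  have "\<exists>S\<in>?A. \<forall>X\<in>?A. S \<subseteq> X \<longrightarrow> X = S"
  proof (rule subset_Zorn_nonempty)
    show "?A \<noteq> {}" using I by blast
    fix \<C> assume ne: "\<C> \<noteq> {}" and C: "subset.chain ?A \<C>"
    have s: "left_ideal (\<Union>\<C>)"
      by (rule left_ideal_Union_chain[OF ne C]) auto
    have CA: "\<C> \<subseteq> ?A" using C by (simp add: subset.chain_def)
    have "1 \<notin> \<Union>\<C>" "I \<subseteq> \<Union>\<C>"
      using ne CA by blast+
    then show "\<Union>\<C> \<in> ?A" using s by blast
  qed
  then obtain S where S: "S \<in> ?A" and "\<forall>X\<in>?A. S \<subseteq> X \<longrightarrow> X = S" ..
  note max = this(2)[rule_format]
  have "X = S \<or> X = UNIV" if "left_ideal X" "S \<subseteq> X" for X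
    using max[of X] that S left_ideal_eq_UNIV by blast
  then show ?thesis using S unfolding maximal_left_ideal_def by blast
qed

lemma left_artinian_minimal:
  assumes art: "left_artinian TYPE('a::ring_1)" and X: "X \<noteq> {}" "\<And>I. I \<in> X \<Longrightarrow> left_ideal (I :: 'a set)"
  shows "\<exists>I\<in>X. \<forall>J\<in>X. J \<subseteq> I \<longrightarrow> J = I"
proof (rule ccontr)
  assume "\<not> ?thesis"
  then have "\<forall>I\<in>X. \<exists>J\<in>X. J \<subset> I" by blast
  then obtain g where g: "\<And>I. I \<in> X \<Longrightarrow> g I \<in> X \<and> g I \<subset> I" by metis
  obtain I0 where I0: "I0 \<in> X" using X by blast
  define f where "f n = (g ^^ n) I0" for n
  have fX: "f n \<in> X" for n by (induction n) (auto simp: f_def I0 g)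
  have dec: "f (Suc n) \<subset> f n" for n using g[OF fX[of n]] by (simp add: f_def)
  have "(\<forall>n. left_ideal (f n)) \<and> (\<forall>n. f (Suc n) \<subseteq> f n)" using fX X dec by blast
  then obtain N where N: "\<forall>n\<ge>N. f n = f N" using art unfolding left_artinian_def by blast
  have "f (Suc N) = f N" by (rule N[rule_format]) simp
  then show False using dec[of N] by blast
qed

text \<open>Expresses that T/M is a division ring without forming the quotient: inverses exist up to
  an error in \<open>M\<close>, so all computations stay in T.\<close>

locale residue_division_ring =
  fixes M :: "'a::ring_1 set"
  assumes left: "left_ideal M"
    and right: "\<And>x r. x \<in> M \<Longrightarrow> x * r \<in> M"
    and one_notin: "1 \<notin> M"
    and left_inverse: "\<And>x. x \<notin> M \<Longrightarrow> \<exists>y. y * x - 1 \<in> M"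

text \<open>For a left ideal \<open>I\<close> this is the subring generated by \<open>I\<close>. For
  a two-sided ideal \<open>M\<close> it is the preimage of the prime subring of T/M, and so supplies
  integer coefficients modulo \<open>M\<close>.\<close>

definition int_plus :: "'a::ring_1 set \<Rightarrow> 'a set" where
  "int_plus I = {of_int k + m |k m. m \<in> I}"

lemma int_plusI: "m \<in> I \<Longrightarrow> of_int k + m \<in> int_plus I"
  unfolding int_plus_def by blast

lemma int_plusE: "x \<in> int_plus I \<Longrightarrow> (\<And>k m. x = of_int k + m \<Longrightarrow> m \<in> I \<Longrightarrow> thesis) \<Longrightarrow> thesis"
  unfolding int_plus_def by blast

lemma subset_int_plus: "I \<subseteq> int_plus I"
  using int_plusI[of _ I 0] by auto

lemma subring_int_plus:
  assumes l: "left_ideal I" shows "is_subring (int_plus I)"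
  unfolding is_subring_def
proof (intro conjI ballI)
  show "1 \<in> int_plus I" using int_plusI[of 0 I 1] left_ideal_zero[OF l] by simp
  fix a b assume "a \<in> int_plus I" "b \<in> int_plus I"
  then obtain k m j n where ab: "a = of_int k + m" "b = of_int j + n" "m \<in> I" "n \<in> I"
    by (metis int_plusE)
  have "a - b = of_int (k - j) + (m - n)" by (simp add: ab)
  then show "a - b \<in> int_plus I" using int_plusI left_ideal_diff[OF l] ab by metis
  have "m * of_int j = of_int j * m" by (rule mult_of_int_commute[symmetric])
  then have "a * b = of_int (k * j) + (of_int k * n + (of_int j * m + m * n))"
    unfolding ab by (simp add: distrib_left distrib_right add.assoc)
  moreover have "of_int k * n + (of_int j * m + m * n) \<in> I"
    by (intro left_ideal_add[OF l] left_ideal_mult[OF l] ab)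
  ultimately show "a * b \<in> int_plus I" using int_plusI by metis
qed

lemma maximal_left_idealD:
  assumes "maximal_left_ideal M"
  shows "left_ideal M" and "1 \<notin> M"
    and "\<And>I x. left_ideal I \<Longrightarrow> M \<subseteq> I \<Longrightarrow> x \<in> I \<Longrightarrow> x \<notin> M \<Longrightarrow> I = UNIV"
  using assms unfolding maximal_left_ideal_def by blast+

lemma maximal_subring_if_maximal_left_ideal_not_two_sided:
  fixes M :: "'a::ring_1 set"
  assumes M: "maximal_left_ideal M" and ni: "x * y \<notin> M" "x \<in> M"
  shows "has_maximal_subring TYPE('a)"
proof -
  have l: "left_ideal M" by (rule maximal_left_idealD(1)[OF M])
  let ?R = "int_plus M"
  \<comment> \<open>Right multiplication by integers and by elements of \<open>M\<close> sends
    \<open>x\<close> into \<open>M\<close>, whereas right multiplication by \<open>y\<close> does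
    not.\<close>
  have "?R \<noteq> UNIV"
  proof
    assume "?R = UNIV"
    then obtain k m where km: "y = of_int k + m" "m \<in> M" by (metis UNIV_I int_plusE)
    have "x * of_int k = of_int k * x" by (rule mult_of_int_commute[symmetric])
    then have "x * y = of_int k * x + x * m" by (simp add: km distrib_left)
    then show False
      using ni left_ideal_add[OF l left_ideal_mult[OF l ni(2)] left_ideal_mult[OF l km(2)]] by simp
  qed
  moreover have "S = UNIV" if S: "is_subring S" "?R \<subseteq> S" "{y} \<subseteq> S" for S
  proof -
    \<comment> \<open>\<open>M + M y\<close> is taken instead of \<open>M + T y\<close>: it is a
      left ideal, larger than \<open>M\<close> because it contains \<open>x * y\<close>, and it lies
      in every subring containing \<open>M\<close> and \<open>y\<close>.\<close>
    let ?I = "{a + b * y |a b. a \<in> M \<and> b \<in> M}"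
    have "left_ideal ?I" by (rule left_ideal_add_principal[OF l l])
    moreover have "M \<subseteq> ?I" by (rule subset_add_principal[OF l])
    moreover have "x * y \<in> ?I"
      using left_ideal_zero[OF l] ni(2) by force
    ultimately have "?I = UNIV" using ni(1) by (rule maximal_left_idealD(3)[OF M])
    moreover have "?I \<subseteq> S"
    proof
      fix s assume "s \<in> ?I"
      then obtain a b where "s = a + b * y" "a \<in> M" "b \<in> M" by blast
      moreover have "M \<subseteq> S" "y \<in> S" using subset_int_plus[of M] S by auto
      ultimately show "s \<in> S" using subring_add[OF S(1)] subring_mult[OF S(1)] by blast
    qed
    ultimately show ?thesis by blast
  qed
  ultimately show ?thesis
    using maximal_subring_if_finitely_generated_extension[OF subring_int_plus[OF l], of "{y}"] by blast
qed

lemma residue_division_ring_maximal: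
  assumes M: "maximal_left_ideal M" and two_sided: "\<And>x y. x \<in> M \<Longrightarrow> x * y \<in> M"
  shows "residue_division_ring M"
proof
  have l: "left_ideal M" using M by (simp add: maximal_left_ideal_def)
  fix x assume x: "x \<notin> M"
  let ?I = "{i + j * x |i j. i \<in> M \<and> j \<in> UNIV}"
  have "x = 0 + 1 * x" by simp
  then have "x \<in> ?I" using left_ideal_zero[OF l] by blast
  then have "?I = UNIV"
    using maximal_left_idealD(3)[OF M left_ideal_add_principal[OF l left_ideal_UNIV]
        subset_add_principal[OF left_ideal_UNIV] _ x] by blast
  then obtain i r where ir: "1 = i + r * x" "i \<in> M" by blast
  then have "r * x - 1 = - i" unfolding ir(1) by simp
  then show "\<exists>y. y * x - 1 \<in> M" using left_ideal_uminus[OF l \<open>i \<in> M\<close>] by metis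
qed (fact maximal_left_idealD(1,2)[OF M] two_sided)+

section \<open>Arithmetic modulo \<open>M\<close>: two-sided inverses and primeness\<close>

context residue_division_ring
begin

lemmas M_zero = left_ideal_zero[OF left]
  and M_diff = left_ideal_diff[OF left]
  and M_add = left_ideal_add[OF left]
  and M_uminus = left_ideal_uminus[OF left]
  and M_sum = left_ideal_sum[OF left]
  and M_left = left_ideal_mult[OF left]

lemma two_sided_inverse:
  assumes "x \<notin> M" shows "\<exists>y. y * x - 1 \<in> M \<and> x * y - 1 \<in> M"
proof -
  obtain y where y: "y * x - 1 \<in> M" using left_inverse assms by blast
  have "y \<notin> M"
  proof
    assume "y \<in> M"
    then have "y * x - (y * x - 1) \<in> M" using right y M_diff by blast
    then show False using one_notin by simp
  qed
  then obtain w where w: "w * y - 1 \<in> M" using left_inverse by blast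
  have "w * (y * x - 1) - (w * y - 1) * x \<in> M" using M_left[OF y] right[OF w] M_diff by blast
  \<comment> \<open>Modulo \<open>M\<close>, \<open>w = w * (y * x) = (w * y) * x = x\<close>, so
    \<open>y\<close> is also a right inverse of \<open>x\<close>.\<close>
  then have wx: "x - w \<in> M" by (simp add: algebra_simps)
  have "(x - w) * y + (w * y - 1) \<in> M" using right[OF wx] w M_add by blast
  then have "x * y - 1 \<in> M" by (simp add: algebra_simps)
  then show ?thesis using y by blast
qed

lemma prime:
  assumes "x * y \<in> M" shows "x \<in> M \<or> y \<in> M"
proof (rule disjCI)
  assume "y \<notin> M"
  then obtain s where s: "y * s - 1 \<in> M" using two_sided_inverse by blast
  have "(x * y) * s - x * (y * s - 1) \<in> M" using right[OF assms] M_left[OF s] M_diff by blast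
  then show "x \<in> M" by (simp add: algebra_simps)
qed

lemma power_notin: "x \<notin> M \<Longrightarrow> x ^ n \<notin> M"
  by (induction n) (auto simp: one_notin dest: prime)

lemma M_cong: "x - y \<in> M \<Longrightarrow> x \<in> M \<longleftrightarrow> y \<in> M"
  using M_add[of "x - y" y] M_diff[of x "x - y"] by auto

section \<open>Commutativity of the residue rings\<close>

text \<open>Gaussian elimination over the division ring T/M, with coefficients on the left and
  unknowns \<open>r j\<close> on the right. The induction removes the last equation, together with
  one unknown unless all coefficients of that equation lie in \<open>M\<close>.\<close>

lemma linear_relation:
  fixes v :: "'b \<Rightarrow> nat \<Rightarrow> 'a"
  assumes "finite J" "n < card J"
  shows "\<exists>r. (\<exists>j\<in>J. r j \<notin> M) \<and> (\<forall>i<n. (\<Sum>j\<in>J. v j i * r j) \<in> M)"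
  using assms
proof (induction n arbitrary: J v)
  case 0
  then have "J \<noteq> {}" by auto
  then show ?case using one_notin by (intro exI[of _ "\<lambda>_. 1"]) auto
next
  case (Suc n)
  show ?case
  proof (cases "\<forall>j\<in>J. v j n \<in> M")
    case True
    obtain r where r: "\<exists>j\<in>J. r j \<notin> M" "\<forall>i<n. (\<Sum>j\<in>J. v j i * r j) \<in> M"
      using Suc.IH[of J v] Suc.prems by auto
    have "(\<Sum>j\<in>J. v j n * r j) \<in> M" using True right by (intro M_sum) blast
    then have "\<forall>i<Suc n. (\<Sum>j\<in>J. v j i * r j) \<in> M" using r(2) less_Suc_eq by auto
    then show ?thesis using r(1) by blast
  next
    case False
    then obtain k where k: "k \<in> J" "v k n \<notin> M" by blast
    obtain q where q: "v k n * q - 1 \<in> M" using two_sided_inverse[OF k(2)] by blast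
    \<comment> \<open>Equation \<open>n\<close>, with pivot \<open>v k n\<close> and
      \<open>q\<close> its inverse modulo \<open>M\<close>, is solved for the unknown
      \<open>r k\<close>. Substituting the result into all equations gives the coefficients
      \<open>v'\<close> and makes equation \<open>n\<close> trivial modulo \<open>M\<close>.\<close>
    define v' where "v' j i = v j i - v k i * (q * v j n)" for j i
    have "finite (J - {k})" "n < card (J - {k})" using Suc.prems k(1) by auto
    from Suc.IH[OF this, of v'] obtain r where r: "\<exists>j\<in>J - {k}. r j \<notin> M"
      "\<forall>i<n. (\<Sum>j\<in>J - {k}. v' j i * r j) \<in> M" by blast
    define r' where "r' = r(k := - (\<Sum>j\<in>J - {k}. q * v j n * r j))"
    have eq: "(\<Sum>j\<in>J. v j i * r' j) = (\<Sum>j\<in>J - {k}. v' j i * r j)" for i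
    proof -
      have "(\<Sum>j\<in>J. v j i * r' j) = v k i * r' k + (\<Sum>j\<in>J - {k}. v j i * r' j)"
        using Suc.prems(1) k(1) by (simp add: sum.remove)
      also have "(\<Sum>j\<in>J - {k}. v j i * r' j) = (\<Sum>j\<in>J - {k}. v j i * r j)"
        by (rule sum.cong) (auto simp: r'_def)
      also have "v k i * r' k = (\<Sum>j\<in>J - {k}. - (v k i * (q * v j n) * r j))"
        by (simp add: r'_def sum_distrib_left sum_negf mult.assoc)
      finally show ?thesis
        by (simp add: v'_def sum.distrib[symmetric] algebra_simps)
    qed
    have "v' j n \<in> M" for j
    proof -
      have "v' j n = - ((v k n * q - 1) * v j n)" by (simp add: v'_def algebra_simps)
      then show ?thesis using M_uminus[OF right[OF q]] by simp
    qed
    then have "(\<Sum>j\<in>J - {k}. v' j n * r j) \<in> M" using right by (intro M_sum) blast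
    then have "\<forall>i<Suc n. (\<Sum>j\<in>J. v j i * r' j) \<in> M" unfolding eq using r(2) less_Suc_eq by auto
    moreover have "\<exists>j\<in>J. r' j \<notin> M" using r(1) by (auto simp: r'_def)
    ultimately show ?thesis by blast
  qed
qed

text \<open>A relation of minimal support among those holding for all \<open>x j * a ^ i\<close>, normalised to
  have one coefficient equal to 1, commutes with \<open>a\<close>: otherwise its commutator with \<open>a\<close>
  would be such a relation of smaller support.\<close>
lemma commuting_relation:
  fixes x :: "'b \<Rightarrow> 'a"
  assumes c: "\<And>i y. i < n \<Longrightarrow> c i * y = y * c i" and a: "a ^ n = (\<Sum>i<n. c i * a ^ i)"
    and J: "finite J" "n < card J"
  shows "\<exists>r. (\<exists>j\<in>J. r j \<notin> M) \<and> (\<forall>j\<in>J. a * r j - r j * a \<in> M) \<and> (\<Sum>j\<in>J. x j * r j) \<in> M"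
proof -
  define Rel where "Rel r \<longleftrightarrow> (\<exists>j\<in>J. r j \<notin> M) \<and> (\<forall>i. (\<Sum>j\<in>J. x j * a ^ i * r j) \<in> M)" for r
  define supp where "supp r = {j \<in> J. r j \<notin> M}" for r :: "'b \<Rightarrow> 'a"
  obtain r0 where r0: "\<exists>j\<in>J. r0 j \<notin> M" "\<forall>i<n. (\<Sum>j\<in>J. x j * a ^ i * r0 j) \<in> M"
    using linear_relation[OF J, of "\<lambda>j i. x j * a ^ i"] by blast
  \<comment> \<open>The finitely many relations with \<open>i < n\<close> imply all others: higher
    powers of \<open>a\<close> reduce by the equation for \<open>a ^ n\<close>, and its central
    coefficients move past \<open>x j\<close>.\<close>
  have "(\<Sum>j\<in>J. x j * a ^ i * r0 j) \<in> M" for i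
  proof (induction i rule: less_induct)
    case (less i)
    show ?case
    proof (cases "i < n")
      case True
      then show ?thesis using r0(2) by blast
    next
      case False
      then have "a ^ i = a ^ n * a ^ (i - n)" by (simp flip: power_add)
      also have "\<dots> = (\<Sum>l<n. c l * a ^ (l + (i - n)))"
        unfolding a sum_distrib_right by (simp add: power_add mult.assoc)
      finally have ai: "a ^ i = (\<Sum>l<n. c l * a ^ (l + (i - n)))" .
      have "x j * a ^ i * r0 j = (\<Sum>l<n. c l * (x j * a ^ (l + (i - n)) * r0 j))" for j
        unfolding ai sum_distrib_left sum_distrib_right
      proof (rule sum.cong[OF refl])
        fix l assume "l \<in> {..<n}"
        then have "x j * c l = c l * x j" using c by simp
        then show "x j * (c l * a ^ (l + (i - n))) * r0 j = c l * (x j * a ^ (l + (i - n)) * r0 j)"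
          by (metis mult.assoc)
      qed
      then have eq: "(\<Sum>j\<in>J. x j * a ^ i * r0 j) = (\<Sum>l<n. c l * (\<Sum>j\<in>J. x j * a ^ (l + (i - n)) * r0 j))"
        using sum.swap[of "\<lambda>j l. c l * (x j * a ^ (l + (i - n)) * r0 j)" "{..<n}" J]
        by (simp add: sum_distrib_left)
      have "(\<Sum>j\<in>J. x j * a ^ (l + (i - n)) * r0 j) \<in> M" if "l < n" for l
        using less.IH[of "l + (i - n)"] that False by simp
      then show ?thesis unfolding eq by (rule M_sum[OF M_left]) simp
    qed
  qed
  then have "Rel r0" using r0(1) by (simp add: Rel_def)
  from ex_has_least_nat[of Rel, OF this, of "\<lambda>r. card (supp r)"]
  obtain r where r: "Rel r" and least: "\<And>r'. Rel r' \<Longrightarrow> card (supp r) \<le> card (supp r')"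
    by blast
  obtain k where k: "k \<in> J" "r k \<notin> M" using r by (auto simp: Rel_def)
  obtain s where s: "r k * s - 1 \<in> M" using two_sided_inverse[OF k(2)] by blast
  have sn: "s \<notin> M"
  proof
    assume "s \<in> M"
    then have "r k * s - (r k * s - 1) \<in> M" using M_left s M_diff by blast
    then show False using one_notin by simp
  qed
  define r1 where "r1 j = r j * s" for j
  have r1: "(\<Sum>j\<in>J. x j * a ^ i * r1 j) \<in> M" for i
  proof -
    have "(\<Sum>j\<in>J. x j * a ^ i * r1 j) = (\<Sum>j\<in>J. x j * a ^ i * r j) * s"
      by (simp add: r1_def sum_distrib_right mult.assoc)
    then show ?thesis using r right by (simp add: Rel_def)
  qed
  define r2 where "r2 j = a * r1 j - r1 j * a" for j
  have sum2: "(\<Sum>j\<in>J. x j * a ^ i * r2 j) \<in> M" for i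
  proof -
    have eq: "(\<Sum>j\<in>J. x j * a ^ i * r2 j)
        = (\<Sum>j\<in>J. x j * a ^ Suc i * r1 j) - (\<Sum>j\<in>J. x j * a ^ i * r1 j) * a"
      unfolding sum_distrib_right sum_subtractf[symmetric]
      by (rule sum.cong) (simp_all add: r2_def right_diff_distrib mult.assoc power_Suc2 del: power_Suc)
    show ?thesis unfolding eq by (intro M_diff right r1)
  qed
  have "r2 j \<in> M" if "j \<in> J" for j
  proof (rule ccontr)
    assume "r2 j \<notin> M"
    then have "Rel r2" unfolding Rel_def using sum2 that by blast
    moreover have "supp r2 \<subset> supp r"
    proof
      have "r2 l \<in> M" if "r l \<in> M" for l
        unfolding r2_def r1_def by (intro M_diff M_left right that)
      then show "supp r2 \<subseteq> supp r" unfolding supp_def by blast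
      \<comment> \<open>The index \<open>k\<close> leaves the support because \<open>r1 k\<close> is
        congruent to 1, which commutes with \<open>a\<close>.\<close>
      have "r2 k = a * (r k * s - 1) - (r k * s - 1) * a" by (simp add: r2_def r1_def algebra_simps)
      then have "r2 k \<in> M" using M_left[OF s] right[OF s] M_diff by simp
      then show "supp r2 \<noteq> supp r" using k by (auto simp: supp_def)
    qed
    then have "card (supp r2) < card (supp r)"
      using J(1) by (intro psubset_card_mono) (auto simp: supp_def)
    ultimately show False using least[of r2] by simp
  qed
  moreover have "r1 k \<notin> M" using prime k sn unfolding r1_def by blast
  moreover have "(\<Sum>j\<in>J. x j * r1 j) \<in> M" using r1[of 0] by simp
  ultimately show ?thesis unfolding r2_def using k(1) by (intro exI[of _ r1]) blast
qed

text \<open>Let \<open>R\<close> be the centralizer of \<open>a\<close> modulo \<open>M\<close>; it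
  omits \<open>b\<close>. If \<open>a\<close> satisfies a monic equation of degree \<open>n\<close>
  with central coefficients, \<open>commuting_relation\<close> allows at most \<open>n\<close>
  elements that are right linearly independent over \<open>R/M\<close>, so a largest independent set
  generates everything together with \<open>R\<close>.\<close>

lemma maximal_subring_if_not_commutative:
  assumes int: "integral_over ring_center a" and nc: "a * b - b * a \<notin> M"
  shows "has_maximal_subring TYPE('a)"
proof -
  obtain n c' where c': "\<And>i. i < n \<Longrightarrow> c' i \<in> ring_center" "a ^ n + (\<Sum>i<n. c' i * a ^ i) = 0"
    using int unfolding integral_over_def by blast
  define c where "c i = - c' i" for i
  have c: "c i * y = y * c i" if "i < n" for i y
    using c'(1)[OF that] by (simp add: c_def ring_center_def)
  have an: "a ^ n = (\<Sum>i<n. c i * a ^ i)"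
    using c'(2) by (simp add: c_def sum_negf add_eq_0_iff2)
  define R where "R = {y. a * y - y * a \<in> M}"
  have MR: "M \<subseteq> R" unfolding R_def by (intro subsetI CollectI M_diff M_left right)
  have subR: "is_subring R"
    unfolding is_subring_def
  proof (intro conjI ballI)
    show "1 \<in> R" by (simp add: R_def M_zero)
    fix y z assume "y \<in> R" "z \<in> R"
    then have yz: "a * y - y * a \<in> M" "a * z - z * a \<in> M" by (auto simp: R_def)
    have "a * (y - z) - (y - z) * a = (a * y - y * a) - (a * z - z * a)"
      by (simp add: algebra_simps)
    then show "y - z \<in> R" using yz M_diff by (simp add: R_def)
    have "a * (y * z) - (y * z) * a = (a * y - y * a) * z + y * (a * z - z * a)"
      by (simp add: algebra_simps)
    then show "y * z \<in> R" using M_add[OF right[OF yz(1)] M_left[OF yz(2)]] by (simp add: R_def)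
  qed
  \<comment> \<open>Right linear independence over \<open>R/M\<close>: relations whose coefficients
    all lie in \<open>M\<close> count as trivial.\<close>
  define Ind where "Ind X \<longleftrightarrow> finite X \<and>
    (\<forall>r. (\<forall>x\<in>X. r x \<in> R) \<longrightarrow> (\<Sum>x\<in>X. x * r x) \<in> M \<longrightarrow> (\<forall>x\<in>X. r x \<in> M))" for X
  have bound: "card X \<le> n" if "Ind X" for X
  proof (rule ccontr)
    assume "\<not> card X \<le> n"
    moreover have "finite X" using that by (simp add: Ind_def)
    ultimately obtain r where "\<exists>j\<in>X. r j \<notin> M" "\<forall>j\<in>X. a * r j - r j * a \<in> M" "(\<Sum>j\<in>X. j * r j) \<in> M"
      using commuting_relation[OF c an, of X "\<lambda>x. x"] by auto
    then show False using that unfolding Ind_def R_def by blast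
  qed
  have "Ind {}" by (simp add: Ind_def)
  moreover have "\<forall>X. Ind X \<longrightarrow> card X < Suc n" using bound le_imp_less_Suc by blast
  ultimately have "\<exists>X. Ind X \<and> (\<forall>Y. Ind Y \<longrightarrow> card Y \<le> card X)"
    by (rule ex_has_greatest_nat[of Ind "{}" card "Suc n"])
  then obtain X where X: "Ind X" and "\<forall>Y. Ind Y \<longrightarrow> card Y \<le> card X"
    by (elim exE conjE)
  note greatest = this(2)[rule_format]
  have finX: "finite X" using X by (simp add: Ind_def)
  have "S = UNIV" if S: "is_subring S" "R \<subseteq> S" "X \<subseteq> S" for S
  proof -
    have "y \<in> S" for y
    proof (cases "y \<in> X")
      case False
      then have "\<not> Ind (insert y X)" using greatest[of "insert y X"] finX by auto
      then obtain r where r: "\<forall>x\<in>insert y X. r x \<in> R" "(\<Sum>x\<in>insert y X. x * r x) \<in> M"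
        "\<not> (\<forall>x\<in>insert y X. r x \<in> M)"
        unfolding Ind_def using finX by blast
      have sum: "y * r y + (\<Sum>x\<in>X. x * r x) \<in> M" using r(2) False finX by simp
      have "r y \<notin> M"
      proof
        assume ry: "r y \<in> M"
        then have "(\<Sum>x\<in>X. x * r x) \<in> M" using M_diff[OF sum M_left[OF ry, of y]] by simp
        then show False using X r(1,3) ry unfolding Ind_def by blast
      qed
      then obtain s where s: "s * r y - 1 \<in> M" "r y * s - 1 \<in> M" using two_sided_inverse by blast
      have ry: "a * r y - r y * a \<in> M" using r(1) by (simp add: R_def)
      \<comment> \<open>Modulo \<open>M\<close>, the inverse of an element commuting with
        \<open>a\<close> commutes with \<open>a\<close>. So \<open>s\<close> lies in
        \<open>R\<close>, and the relation can be solved for \<open>y\<close> inside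
        \<open>S\<close>.\<close>
      have "a * s - s * a = s * (r y * a - a * r y) * s - (s * r y - 1) * a * s + s * a * (r y * s - 1)"
        by (simp add: algebra_simps)
      moreover have "\<dots> \<in> M"
        using M_add[OF M_diff[OF right[OF M_left[OF M_uminus[OF ry]]] right[OF right[OF s(1)]]] M_left[OF s(2)]]
        by simp
      ultimately have "s \<in> R" by (simp add: R_def)
      have "y = (y * r y + (\<Sum>x\<in>X. x * r x)) * s - (\<Sum>x\<in>X. x * r x) * s - y * (r y * s - 1)"
        by (simp add: algebra_simps)
      also have "\<dots> \<in> S"
      proof (intro subring_diff[OF S(1)])
        show "(y * r y + (\<Sum>x\<in>X. x * r x)) * s \<in> S" using right[OF sum] MR S(2) by blast
        show "y * (r y * s - 1) \<in> S" using M_left[OF s(2)] MR S(2) by blast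
        show "(\<Sum>x\<in>X. x * r x) * s \<in> S"
          using S r(1) \<open>s \<in> R\<close> by (intro subring_mult[OF S(1)] subring_sum[OF S(1)]) auto
      qed
      finally show ?thesis .
    qed (use S in blast)
    then show ?thesis by blast
  qed
  moreover have "R \<noteq> UNIV" using nc by (auto simp: R_def)
  ultimately show ?thesis
    using maximal_subring_if_finitely_generated_extension[OF subR _ finX] by blast
qed

end

section \<open>Residue fields\<close>

locale residue_field = residue_division_ring M for M :: "'a::ring_1 set" +
  assumes commute: "x * y - y * x \<in> M"
begin

definition eqv :: "'a \<Rightarrow> 'a \<Rightarrow> bool" (infix "\<approx>" 50) where
  "x \<approx> y \<longleftrightarrow> x - y \<in> M"

lemma eqv_refl [simp]: "x \<approx> x"
  by (simp add: eqv_def M_zero)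

lemma eqv_sym: "x \<approx> y \<Longrightarrow> y \<approx> x"
  unfolding eqv_def using M_uminus[of "x - y"] by simp

lemma eqv_trans [trans]: "x \<approx> y \<Longrightarrow> y \<approx> z \<Longrightarrow> x \<approx> z"
  unfolding eqv_def using M_add[of "x - y" "y - z"] by simp

lemma eqv_add: "x \<approx> x' \<Longrightarrow> y \<approx> y' \<Longrightarrow> x + y \<approx> x' + y'"
  unfolding eqv_def using M_add[of "x - x'" "y - y'"] by (simp add: algebra_simps)

lemma eqv_uminus: "x \<approx> x' \<Longrightarrow> - x \<approx> - x'"
  unfolding eqv_def using M_uminus[of "x - x'"] by (simp add: algebra_simps)

lemma eqv_diff: "x \<approx> x' \<Longrightarrow> y \<approx> y' \<Longrightarrow> x - y \<approx> x' - y'"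
  using eqv_add[OF _ eqv_uminus, of x x' y y'] by simp

lemma eqv_mult: "x \<approx> x' \<Longrightarrow> y \<approx> y' \<Longrightarrow> x * y \<approx> x' * y'"
  unfolding eqv_def
  using M_add[OF right[of "x - x'" y] M_left[of "y - y'" x']] by (simp add: algebra_simps)

lemma eqv_power: "x \<approx> x' \<Longrightarrow> x ^ n \<approx> x' ^ n"
  by (induction n) (auto intro: eqv_mult)

lemma eqv_commute: "x * y \<approx> y * x"
  unfolding eqv_def by (rule commute)

lemma eqv_left_commute: "x * (y * z) \<approx> y * (x * z)"
  using eqv_mult[OF eqv_commute[of x y] eqv_refl[of z]] by (simp add: mult.assoc)

lemma eqv_zero: "x \<approx> 0 \<longleftrightarrow> x \<in> M"
  by (simp add: eqv_def)

lemma eqv_power_mult: "(x * y) ^ n \<approx> x ^ n * y ^ n"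
proof (induction n)
  case (Suc n)
  have "(x * y) ^ Suc n \<approx> (x * y) * (x ^ n * y ^ n)"
    using eqv_mult[OF eqv_refl Suc] by simp
  also have "(x * y) * (x ^ n * y ^ n) = x * (y * (x ^ n * y ^ n))"
    by (simp add: mult.assoc)
  also have "\<dots> \<approx> x * (x ^ n * (y * y ^ n))"
    by (intro eqv_mult eqv_refl eqv_left_commute)
  finally show ?case by (simp add: mult.assoc)
qed simp

section \<open>Subrings containing \<open>M\<close> and polynomial expressions over them\<close>

definition M_module :: "'a set \<Rightarrow> bool" where
  "M_module B \<longleftrightarrow> M \<subseteq> B \<and> (\<forall>x\<in>B. \<forall>y\<in>B. x - y \<in> B)"

definition M_subring :: "'a set \<Rightarrow> bool" where
  "M_subring A \<longleftrightarrow> M \<subseteq> A \<and> is_subring A"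

lemma M_subring_module: "M_subring A \<Longrightarrow> M_module A"
  by (simp add: M_subring_def M_module_def is_subring_def)

lemma M_moduleD:
  assumes "M_module B"
  shows M_module_M: "x \<in> M \<Longrightarrow> x \<in> B"
    and M_module_diff: "x \<in> B \<Longrightarrow> y \<in> B \<Longrightarrow> x - y \<in> B"
  using assms by (auto simp: M_module_def)

lemma M_module_zero: "M_module B \<Longrightarrow> 0 \<in> B"
  using M_module_M M_zero by blast

lemma M_module_add:
  assumes "M_module B" "x \<in> B" "y \<in> B" shows "x + y \<in> B"
  using M_module_diff[OF assms(1,2) M_module_diff[OF assms(1) M_module_zero[OF assms(1)] assms(3)]]
  by simp

lemma M_module_eqv:
  assumes "M_module B" "x \<approx> y" "y \<in> B" shows "x \<in> B"
  using M_module_add[OF assms(1) M_module_M[OF assms(1)] assms(3), of "x - y"] assms(2)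
  by (simp add: eqv_def)

lemma M_subringD:
  assumes "M_subring A"
  shows M_subring_M: "x \<in> M \<Longrightarrow> x \<in> A"
    and M_subring_one: "1 \<in> A"
    and M_subring_diff: "x \<in> A \<Longrightarrow> y \<in> A \<Longrightarrow> x - y \<in> A"
    and M_subring_add: "x \<in> A \<Longrightarrow> y \<in> A \<Longrightarrow> x + y \<in> A"
    and M_subring_mult: "x \<in> A \<Longrightarrow> y \<in> A \<Longrightarrow> x * y \<in> A"
    and M_subring_uminus: "x \<in> A \<Longrightarrow> - x \<in> A"
    and M_subring_power: "x \<in> A \<Longrightarrow> x ^ n \<in> A"
    and M_subring_eqv: "x \<approx> y \<Longrightarrow> y \<in> A \<Longrightarrow> x \<in> A"
  using assms M_module_eqv[OF M_subring_module[OF assms], of x y]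
  by (auto simp: M_subring_def subring_one subring_diff subring_add subring_mult subring_uminus subring_power)

text \<open>The elements that are congruent modulo \<open>M\<close> to a polynomial in \<open>t\<close> of degree less than \<open>n\<close>
  with coefficients in \<open>B\<close>.\<close>
primrec polyspan :: "'a set \<Rightarrow> 'a \<Rightarrow> nat \<Rightarrow> 'a set" where
  "polyspan B t 0 = M"
| "polyspan B t (Suc n) = {w + b * t ^ n |w b. w \<in> polyspan B t n \<and> b \<in> B}"

lemma polyspan_SucI: "w \<in> polyspan B t n \<Longrightarrow> b \<in> B \<Longrightarrow> w + b * t ^ n \<in> polyspan B t (Suc n)"
  by auto

lemma polyspan_SucE:
  assumes "u \<in> polyspan B t (Suc n)"
  obtains w b where "u = w + b * t ^ n" "w \<in> polyspan B t n" "b \<in> B"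
  using assms by auto

lemma polyspan_Suc_mono:
  assumes "M_module B" shows "polyspan B t n \<subseteq> polyspan B t (Suc n)"
proof
  fix u assume "u \<in> polyspan B t n"
  from polyspan_SucI[OF this M_module_zero[OF assms]] show "u \<in> polyspan B t (Suc n)"
    by (simp del: polyspan.simps)
qed

lemma polyspan_mono: "M_module B \<Longrightarrow> n \<le> m \<Longrightarrow> polyspan B t n \<subseteq> polyspan B t m"
  by (rule lift_Suc_mono_le) (rule polyspan_Suc_mono)

text \<open>A set \<open>polyspan B t n\<close> is in general no subring, only an additive subgroup
  containing \<open>M\<close>. This weaker notion lets it serve as a set of coefficients in turn,
  which gives polynomials in two elements.\<close>

lemma polyspan_module:
  assumes B: "M_module B" shows "M_module (polyspan B t n)"
proof (induction n)
  case 0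
  then show ?case by (auto simp: M_module_def M_diff)
next
  case (Suc n)
  have "x - y \<in> polyspan B t (Suc n)"
    if x: "x \<in> polyspan B t (Suc n)" and y: "y \<in> polyspan B t (Suc n)" for x y
  proof -
    obtain w b where 1: "x = w + b * t ^ n" "w \<in> polyspan B t n" "b \<in> B"
      using x by (rule polyspan_SucE)
    obtain v c where 2: "y = v + c * t ^ n" "v \<in> polyspan B t n" "c \<in> B"
      using y by (rule polyspan_SucE)
    have "x - y = (w - v) + (b - c) * t ^ n" by (simp add: 1 2 algebra_simps)
    moreover have "\<dots> \<in> polyspan B t (Suc n)"
      using 1 2 by (intro polyspan_SucI M_module_diff[OF Suc] M_module_diff[OF B])
    ultimately show ?thesis by metis
  qed
  moreover have "M \<subseteq> polyspan B t (Suc n)"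
    using polyspan_Suc_mono[OF B, of t n] Suc unfolding M_module_def by blast
  ultimately show ?case unfolding M_module_def by blast
qed

lemma polyspan_mono_set: "B \<subseteq> C \<Longrightarrow> polyspan B t n \<subseteq> polyspan C t n"
proof (induction n)
  case (Suc n)
  then show ?case by (fastforce elim!: polyspan_SucE)
qed simp

lemma polyspan_monom:
  assumes "M_module B" "b \<in> B" shows "b * t ^ n \<in> polyspan B t (Suc n)"
  using polyspan_SucI[OF M_module_zero[OF polyspan_module[OF assms(1)]] assms(2), of t n]
  by (simp del: polyspan.simps)

lemma polyspan_shift:
  assumes B: "M_module B" shows "u \<in> polyspan B t n \<Longrightarrow> t * u \<in> polyspan B t (Suc n)"
proof (induction n arbitrary: u)
  case 0
  then have "t * u \<in> M" using M_left by simp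
  then show ?case by (rule M_module_M[OF polyspan_module[OF B]])
next
  case (Suc n)
  obtain w b where 1: "u = w + b * t ^ n" "w \<in> polyspan B t n" "b \<in> B"
    using Suc.prems by (rule polyspan_SucE)
  have "t * u \<approx> t * w + b * t ^ Suc n"
    using eqv_add[OF eqv_refl eqv_left_commute, of "t * w" t b "t ^ n"]
    by (simp add: 1 distrib_left)
  moreover have "t * w + b * t ^ Suc n \<in> polyspan B t (Suc (Suc n))"
    by (rule polyspan_SucI[OF Suc.IH[OF 1(2)] 1(3)])
  ultimately show ?case by (rule M_module_eqv[OF polyspan_module[OF B]])
qed

lemma polyspan_shift_power:
  assumes B: "M_module B" "u \<in> polyspan B t n"
  shows "t ^ k * u \<in> polyspan B t (n + k)"
proof (induction k)
  case (Suc k)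
  then show ?case using polyspan_shift[OF B(1)] by (metis add_Suc_right mult.assoc power_Suc)
qed (use assms in simp)

lemma polyspan_scale:
  assumes A: "M_subring A" "a \<in> A"
  shows "u \<in> polyspan A t n \<Longrightarrow> a * u \<in> polyspan A t n"
proof (induction n arbitrary: u)
  case 0
  then show ?case using M_left by simp
next
  case (Suc n)
  obtain w b where 1: "u = w + b * t ^ n" "w \<in> polyspan A t n" "b \<in> A"
    using Suc.prems by (rule polyspan_SucE)
  have "a * u = a * w + (a * b) * t ^ n" by (simp add: 1 algebra_simps)
  moreover have "\<dots> \<in> polyspan A t (Suc n)"
    by (intro polyspan_SucI Suc.IH M_subring_mult A 1)
  ultimately show ?case by metis
qed

lemma polyspan_mult:
  assumes A: "M_subring A" "v \<in> polyspan A t m"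
  shows "u \<in> polyspan A t n \<Longrightarrow> u * v \<in> polyspan A t (m + n)"
proof (induction n arbitrary: u)
  case 0
  then have "u * v \<in> M" using right by simp
  then show ?case by (rule M_module_M[OF polyspan_module[OF M_subring_module[OF A(1)]]])
next
  case (Suc n)
  note mod = polyspan_module[OF M_subring_module[OF A(1)]]
  obtain w b where 1: "u = w + b * t ^ n" "w \<in> polyspan A t n" "b \<in> A"
    using Suc.prems by (rule polyspan_SucE)
  have "u * v = w * v + b * (t ^ n * v)" by (simp add: 1 algebra_simps)
  moreover have "\<dots> \<in> polyspan A t (m + n)"
    by (intro M_module_add[OF mod] Suc.IH 1 polyspan_scale[OF A(1)]
        polyspan_shift_power[OF M_subring_module[OF A(1)]] A(2))
  ultimately show ?case
    using polyspan_Suc_mono[OF M_subring_module[OF A(1)], of t "m + n"] by auto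
qed

section \<open>Adjoining an element, integrality and localization modulo \<open>M\<close>\<close>

definition adjoin :: "'a set \<Rightarrow> 'a \<Rightarrow> 'a set" where
  "adjoin A t = (\<Union>n. polyspan A t n)"

lemma adjoinI: "u \<in> polyspan A t n \<Longrightarrow> u \<in> adjoin A t"
  unfolding adjoin_def by blast

lemma adjoinE:
  assumes "u \<in> adjoin A t"
  obtains n where "u \<in> polyspan A t n"
  using assms unfolding adjoin_def by blast

lemma polyspan_1:
  assumes "M_module B" shows "B \<subseteq> polyspan B t (Suc 0)"
  using polyspan_monom[OF assms, of _ t 0] by (auto simp del: polyspan.simps)

lemma subset_adjoin: "M_subring A \<Longrightarrow> A \<subseteq> adjoin A t"
  using polyspan_1[OF M_subring_module] adjoinI by blast

lemma adjoin_self: "M_subring A \<Longrightarrow> t \<in> adjoin A t"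
  using polyspan_monom[OF M_subring_module M_subring_one, of A t 1]
  by (auto intro!: adjoinI simp del: polyspan.simps)

lemma M_subring_adjoin:
  assumes A: "M_subring A" shows "M_subring (adjoin A t)"
  unfolding M_subring_def is_subring_def
proof (intro conjI ballI)
  show "M \<subseteq> adjoin A t" "1 \<in> adjoin A t"
    using subset_adjoin[OF A] M_subring_M[OF A] M_subring_one[OF A] by blast+
  fix x y assume "x \<in> adjoin A t" "y \<in> adjoin A t"
  then obtain m n where mn: "x \<in> polyspan A t m" "y \<in> polyspan A t n" by (metis adjoinE)
  then show "x * y \<in> adjoin A t" using polyspan_mult[OF A] adjoinI by blast
  note mono = polyspan_mono[OF M_subring_module[OF A], of _ "max m n" t]
  have "x \<in> polyspan A t (max m n)" "y \<in> polyspan A t (max m n)"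
    using mn mono[of m] mono[of n] by auto
  from M_module_diff[OF polyspan_module[OF M_subring_module[OF A]] this]
  show "x - y \<in> adjoin A t" by (rule adjoinI)
qed

text \<open>A monic relation of degree \<open>n\<close> rewrites \<open>t ^ n\<close>, so the span
  of the lower powers is stable under multiplication by \<open>t\<close>. It therefore contains
  every power of \<open>t\<close>.\<close>

lemma polyspan_integral:
  assumes A: "M_subring A" and t: "t ^ n \<in> polyspan A t n"
  shows "adjoin A t = polyspan A t n"
proof
  note mod = M_subring_module[OF A]
  note smod = polyspan_module[OF mod]
  have step: "t * u \<in> polyspan A t n" if u: "u \<in> polyspan A t n" for u
  proof (cases n)
    case 0
    then show ?thesis using u M_left by simp
  next
    case (Suc m)
    obtain w b where 1: "u = w + b * t ^ m" "w \<in> polyspan A t m" "b \<in> A"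
      using u unfolding Suc by (rule polyspan_SucE)
    have "t * u \<approx> t * w + b * t ^ n"
      using eqv_add[OF eqv_refl eqv_left_commute, of "t * w" t b "t ^ m"]
      by (simp add: 1 distrib_left Suc)
    moreover have "t * w + b * t ^ n \<in> polyspan A t n"
      using polyspan_shift[OF mod 1(2)] polyspan_scale[OF A 1(3) t] M_module_add[OF smod]
      unfolding Suc by blast
    ultimately show ?thesis by (rule M_module_eqv[OF smod])
  qed
  have pow: "t ^ k \<in> polyspan A t n" for k
  proof (induction k)
    case 0
    show ?case
    proof (cases n)
      case 0
      then show ?thesis using t by simp
    next
      case (Suc m)
      then have "polyspan A t (Suc 0) \<subseteq> polyspan A t n" by (intro polyspan_mono[OF mod]) simp
      then show ?thesis using polyspan_1[OF mod, of t] M_subring_one[OF A] by auto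
    qed
  next
    case (Suc k)
    then show ?case using step by simp
  qed
  have "polyspan A t m \<subseteq> polyspan A t n" for m
  proof (induction m)
    case 0
    then show ?case using M_module_M[OF smod] by auto
  next
    case (Suc m)
    show ?case
    proof
      fix u assume "u \<in> polyspan A t (Suc m)"
      then obtain w b where "u = w + b * t ^ m" "w \<in> polyspan A t m" "b \<in> A" by (rule polyspan_SucE)
      then show "u \<in> polyspan A t n"
        using Suc polyspan_scale[OF A _ pow] M_module_add[OF smod] by blast
    qed
  qed
  then show "adjoin A t \<subseteq> polyspan A t n" unfolding adjoin_def by blast
  show "polyspan A t n \<subseteq> adjoin A t" using adjoinI by blast
qed

text \<open>Localization at the powers of \<open>f\<close> without fractions: for \<open>f\<close>
  outside \<open>M\<close>, the elements \<open>y\<close> represent the quotients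
  \<open>r / f ^ k\<close> in T/M.\<close>

lemma M_subring_localization:
  assumes R: "M_subring R" "f \<in> R"
  shows "M_subring {y. \<exists>k. f ^ k * y \<in> R}"
  unfolding M_subring_def is_subring_def
proof (intro conjI ballI)
  let ?L = "{y. \<exists>k. f ^ k * y \<in> R}"
  have RL: "y \<in> ?L" if "y \<in> R" for y using that by (auto intro!: exI[of _ 0])
  then show "M \<subseteq> ?L" "1 \<in> ?L" using M_subring_M[OF R(1)] M_subring_one[OF R(1)] by blast+
  fix y z assume "y \<in> ?L" "z \<in> ?L"
  then obtain k l where kl: "f ^ k * y \<in> R" "f ^ l * z \<in> R" by blast
  have "f ^ (k + l) * (y - z) = f ^ l * (f ^ k * y) - f ^ k * (f ^ l * z)"
    by (simp add: right_diff_distrib mult.assoc[symmetric] power_add[symmetric] add.commute)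
  moreover have "\<dots> \<in> R"
    by (intro M_subring_diff[OF R(1)] M_subring_mult[OF R(1) M_subring_power[OF R]] kl)
  ultimately show "y - z \<in> ?L" by (intro CollectI exI[of _ "k + l"]) simp
  have "f ^ (k + l) * (y * z) = f ^ k * (f ^ l * (y * z))"
    by (simp add: power_add mult.assoc)
  also have "\<dots> \<approx> f ^ k * (y * (f ^ l * z))"
    by (intro eqv_mult eqv_refl eqv_left_commute)
  also have "\<dots> = (f ^ k * y) * (f ^ l * z)" by (simp add: mult.assoc)
  finally have "f ^ (k + l) * (y * z) \<in> R"
    using kl R(1) by (blast intro: M_subring_eqv M_subring_mult)
  then show "y * z \<in> ?L" by blast
qed

text \<open>Modulo \<open>M\<close>,
  \<open>b ^ k * c * t ^ i = c * b ^ (k - i) * (b * t) ^ i\<close> for \<open>i \<le> k\<close>, and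
  degrees below \<open>m\<close> are at most \<open>k\<close>. The lemma serves to make an algebraic
  element integral by multiplying it by its leading coefficient.\<close>

lemma polyspan_scale_argument:
  assumes A: "M_subring A" "b \<in> A"
  shows "u \<in> polyspan A t m \<Longrightarrow> m \<le> Suc k \<Longrightarrow> b ^ k * u \<in> polyspan A (b * t) m"
proof (induction m arbitrary: u)
  case 0
  then show ?case using M_left by simp
next
  case (Suc m)
  obtain w c where 1: "u = w + c * t ^ m" "w \<in> polyspan A t m" "c \<in> A"
    using Suc.prems(1) by (rule polyspan_SucE)
  have bk: "b ^ k = b ^ (k - m) * b ^ m" using Suc.prems(2) by (simp flip: power_add)
  have "b ^ k * (c * t ^ m) \<approx> c * (b ^ k * t ^ m)" by (rule eqv_left_commute)
  also have "c * (b ^ k * t ^ m) = c * b ^ (k - m) * (b ^ m * t ^ m)"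
    by (simp add: bk mult.assoc)
  also have "\<dots> \<approx> c * b ^ (k - m) * (b * t) ^ m"
    by (intro eqv_mult eqv_refl eqv_sym[OF eqv_power_mult])
  finally have "b ^ k * (c * t ^ m) \<approx> c * b ^ (k - m) * (b * t) ^ m" .
  then have "b ^ k * u \<approx> b ^ k * w + c * b ^ (k - m) * (b * t) ^ m"
    unfolding 1 distrib_left by (intro eqv_add eqv_refl)
  moreover have "b ^ k * w + c * b ^ (k - m) * (b * t) ^ m \<in> polyspan A (b * t) (Suc m)"
    using Suc.prems(2) by (intro polyspan_SucI Suc.IH 1 M_subring_mult M_subring_power A) simp
  ultimately show ?case
    by (rule M_module_eqv[OF polyspan_module[OF M_subring_module[OF A(1)]]])
qed

text \<open>Here \<open>a\<close> is the leading coefficient of a relation of degree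
  \<open>n\<close>: nonzero modulo \<open>M\<close>, but possibly not invertible in
  \<open>A\<close>. Degree 0 cannot occur, as it would put \<open>a\<close> into
  \<open>M\<close>.\<close>

definition algebraic :: "'a set \<Rightarrow> 'a \<Rightarrow> bool" where
  "algebraic A t \<longleftrightarrow> (\<exists>n. \<exists>a\<in>A. a \<notin> M \<and> a * t ^ n \<in> polyspan A t n)"

lemma ex_maximal_M_subring:
  assumes R: "M_subring R" "P R"
    and P: "\<And>\<C>. \<C> \<noteq> {} \<Longrightarrow> subset.chain {S. M_subring S \<and> R \<subseteq> S \<and> P S} \<C> \<Longrightarrow> P (\<Union>\<C>)"
  obtains S where "M_subring S" "R \<subseteq> S" "P S"
    and "\<And>T. M_subring T \<Longrightarrow> S \<subseteq> T \<Longrightarrow> P T \<Longrightarrow> T = S"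
proof -
  let ?A = "{S. M_subring S \<and> R \<subseteq> S \<and> P S}"
  have "\<exists>S\<in>?A. \<forall>T\<in>?A. S \<subseteq> T \<longrightarrow> T = S"
  proof (rule subset_Zorn_nonempty)
    show "?A \<noteq> {}" using R by blast
    fix \<C> assume ne: "\<C> \<noteq> {}" and C: "subset.chain ?A \<C>"
    have CA: "\<C> \<subseteq> ?A" using C by (simp add: subset.chain_def)
    have "is_subring (\<Union>\<C>)"
      by (rule subring_Union_chain[OF ne C]) (simp add: M_subring_def)
    moreover have "M \<subseteq> \<Union>\<C>" "R \<subseteq> \<Union>\<C>"
      using ne CA unfolding M_subring_def by blast+
    ultimately show "\<Union>\<C> \<in> ?A" using P[OF ne C] by (simp add: M_subring_def)
  qed
  then obtain S where S: "S \<in> ?A" and "\<forall>T\<in>?A. S \<subseteq> T \<longrightarrow> T = S" ..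
  note max = this(2)[rule_format]
  show ?thesis
  proof (rule that)
    show "T = S" if "M_subring T" "S \<subseteq> T" "P T" for T
      using max[of T] S that by blast
  qed (use S in auto)
qed

text \<open>The maximal subring is a subring \<open>R\<close> containing \<open>A\<close> and maximal without \<open>z\<close>, the inverse
  of \<open>x\<close>: it is integrally closed modulo \<open>M\<close> because \<open>x\<close> lies in its Jacobson radical,
  and together with \<open>z\<close> it generates everything.\<close>
lemma maximal_subring_if_divided:
  assumes A: "M_subring A" "x \<in> A" and z: "z \<notin> A" "x * z \<approx> 1"
    and divided: "\<And>a. a \<in> A \<Longrightarrow> a \<notin> M \<Longrightarrow> \<exists>c\<in>A. \<exists>k. \<exists>g\<in>A. c * a \<approx> x ^ k * (1 + x * g)"
    and alg: "\<And>t. algebraic A t"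
  shows "has_maximal_subring TYPE('a)"
proof -
  obtain R where R: "M_subring R" "A \<subseteq> R" "z \<notin> R"
    and max: "\<And>S. M_subring S \<Longrightarrow> R \<subseteq> S \<Longrightarrow> z \<notin> S \<Longrightarrow> S = R"
  proof (rule ex_maximal_M_subring[OF A(1), of "\<lambda>S. z \<notin> S"])
    show "z \<notin> \<Union>\<C>" if "subset.chain {S. M_subring S \<and> A \<subseteq> S \<and> z \<notin> S} \<C>" for \<C>
      using that unfolding subset.chain_def by blast
  qed (use z in auto)
  note R_intros = M_subring_add[OF R(1)] M_subring_mult[OF R(1)] M_subring_power[OF R(1)]
    M_subring_one[OF R(1)] M_subring_uminus[OF R(1)]
  have xR: "x \<in> R" using A R by blast
  note mod = M_subring_module[OF R(1)]
  note smod = polyspan_module[OF mod]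
  have zx: "z * x \<approx> 1" using eqv_trans[OF eqv_commute z(2)] .
  \<comment> \<open>For \<open>f = 1 + x * g\<close> each power has the form
    \<open>f ^ k = 1 + x * h\<close>, so \<open>z\<close> is congruent to
    \<open>f ^ k * z - h\<close>. Hence localizing \<open>R\<close> at \<open>f\<close> does not add
    \<open>z\<close>, and by maximality of \<open>R\<close> the inverse of \<open>f\<close> is
    already in \<open>R\<close>.\<close>
  have unit: "\<exists>e\<in>R. e * (1 + x * g) \<approx> 1" if g: "g \<in> R" for g
  proof -
    define f where "f = 1 + x * g"
    have fR: "f \<in> R" unfolding f_def by (intro R_intros xR g)
    have notz: "f ^ k * z \<notin> R" for k
    proof
      assume fz: "f ^ k * z \<in> R"
      have "\<exists>h\<in>R. f ^ k = 1 + x * h"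
      proof (induction k)
        case 0
        then show ?case using M_subring_M[OF R(1) M_zero] by force
      next
        case (Suc k)
        then obtain h where h: "h \<in> R" "f ^ k = 1 + x * h" by blast
        have "f ^ Suc k = f * (1 + x * h)" by (simp add: h)
        also have "\<dots> = 1 + x * (h + g + g * x * h)" by (simp add: f_def algebra_simps)
        finally have "f ^ Suc k = 1 + x * (h + g + g * x * h)" .
        moreover have "h + g + g * x * h \<in> R" by (intro R_intros g xR h)
        ultimately show ?case by blast
      qed
      then obtain h where h: "h \<in> R" "f ^ k = 1 + x * h" by blast
      have "x * (h * z) \<approx> h * (x * z)" by (rule eqv_left_commute)
      also have "\<dots> \<approx> h * 1" by (intro eqv_mult eqv_refl z)
      finally have "f ^ k * z - x * (h * z) \<approx> f ^ k * z - h" by (simp add: eqv_diff)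
      moreover have "z = f ^ k * z - x * (h * z)" by (simp add: h algebra_simps)
      ultimately have "z \<in> R"
        using M_subring_eqv[OF R(1), of z "f ^ k * z - h"] M_subring_diff[OF R(1) fz h(1)] by simp
      then show False using R by blast
    qed
    have "f \<notin> M" using notz[of 1] M_subring_M[OF R(1) right, of f z] by auto
    then obtain e where e: "e * f - 1 \<in> M" "f * e - 1 \<in> M" using two_sided_inverse by blast
    let ?L = "{y. \<exists>k. f ^ k * y \<in> R}"
    have "?L = R"
    proof (rule max)
      show "M_subring ?L" by (rule M_subring_localization[OF R(1) fR])
      show "R \<subseteq> ?L" by (auto intro!: exI[of _ 0])
      show "z \<notin> ?L" using notz by blast
    qed
    moreover have "f ^ 1 * e \<in> R"
      using M_subring_eqv[OF R(1), of "f * e" 1] e(2) M_subring_one[OF R(1)] by (simp add: eqv_def)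
    ultimately have "e \<in> R" by blast
    then show ?thesis using e(1) unfolding f_def eqv_def by blast
  qed
  have closed: "w \<in> R" if "w ^ n \<in> polyspan R w n" for w n
  proof (rule ccontr)
    assume w: "w \<notin> R"
    define n where "n = (LEAST n. w ^ n \<in> polyspan R w n)"
    have n: "w ^ n \<in> polyspan R w n" unfolding n_def using that by (rule LeastI)
    have "n \<noteq> 0" using n one_notin by (cases n) auto
    then obtain m where m: "n = Suc m" using not0_implies_Suc by blast
    have eq: "adjoin R w = polyspan R w n" by (rule polyspan_integral[OF R(1) n])
    have sub: "M_subring (adjoin R w)" by (rule M_subring_adjoin[OF R(1)])
    have self: "w \<in> adjoin R w" by (rule adjoin_self[OF R(1)])
    have "z \<in> adjoin R w"
    proof (rule ccontr)
      assume "z \<notin> adjoin R w"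
      then have "adjoin R w = R" by (rule max[OF sub subset_adjoin[OF R(1)]])
      then show False using w self by simp
    qed
    \<comment> \<open>Write \<open>z * w ^ m = v + b * w ^ m\<close> with \<open>v\<close> of lower
      degree. Multiplying by \<open>x\<close> gives \<open>(1 - x * b) * w ^ m = x * v\<close>
      modulo \<open>M\<close>, and inverting the unit \<open>1 - x * b\<close> yields an integral
      equation of degree \<open>m\<close>, against the choice of \<open>n\<close>.\<close>
    then have "z * w ^ m \<in> polyspan R w (Suc m)"
      using M_subring_mult[OF sub _ M_subring_power[OF sub self]] eq m by metis
    then obtain v b where vb: "z * w ^ m = v + b * w ^ m" "v \<in> polyspan R w m" "b \<in> R"
      by (rule polyspan_SucE)
    obtain e where e: "e \<in> R" "e * (1 + x * (- b)) \<approx> 1"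
      using unit[OF M_subring_uminus[OF R(1) vb(3)]] by blast
    have "w ^ m \<approx> x * (z * w ^ m)"
      using eqv_sym[OF eqv_mult[OF z(2) eqv_refl[of "w ^ m"]]] by (simp add: mult.assoc)
    then have "w ^ m - x * b * w ^ m \<approx> x * (z * w ^ m) - x * b * w ^ m"
      by (intro eqv_diff eqv_refl)
    also have "\<dots> = x * v" by (simp add: vb(1) algebra_simps)
    finally have "(1 + x * (- b)) * w ^ m \<approx> x * v" by (simp add: algebra_simps)
    then have "e * ((1 + x * (- b)) * w ^ m) \<approx> e * (x * v)" by (rule eqv_mult[OF eqv_refl])
    moreover have "w ^ m \<approx> e * ((1 + x * (- b)) * w ^ m)"
      using eqv_sym[OF eqv_mult[OF e(2) eqv_refl[of "w ^ m"]]] by (simp add: mult.assoc)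
    ultimately have "w ^ m \<approx> e * (x * v)" by (rule eqv_trans[rotated])
    moreover have "e * (x * v) \<in> polyspan R w m"
      by (intro polyspan_scale[OF R(1)] e xR vb)
    ultimately have "w ^ m \<in> polyspan R w m" by (rule M_module_eqv[OF smod])
    then have "n \<le> m" unfolding n_def by (rule Least_le)
    then show False using m by simp
  qed
  have gen: "S = UNIV" if S: "is_subring S" "R \<subseteq> S" "z \<in> S" for S
  proof -
    have "t \<in> S" for t
    proof -
      obtain n a where a: "a \<in> A" "a \<notin> M" "a * t ^ n \<in> polyspan A t n"
        using alg[of t] unfolding algebraic_def by blast
      obtain c k g where c: "c \<in> A" "g \<in> A" "c * a \<approx> x ^ k * (1 + x * g)"
        using divided[OF a(1,2)] by blast
      obtain e where e: "e \<in> R" "e * (1 + x * g) \<approx> 1" using unit c R by blast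
      \<comment> \<open>Since \<open>1 + x * g\<close> is a unit of \<open>R\<close>, some multiple
        of the leading coefficient \<open>a\<close> is congruent to \<open>x ^ k\<close>, so
        \<open>b\<close> can replace \<open>a\<close> over \<open>R\<close>. Then
        \<open>b * t\<close> is integral over \<open>R\<close>, hence in \<open>R\<close>, and
        \<open>t\<close> is recovered as \<open>z ^ k * (b * t)\<close>.\<close>
      define b where "b = x ^ k"
      have bR: "b \<in> R" unfolding b_def by (intro R_intros xR)
      have "e * (c * a) \<approx> e * (b * (1 + x * g))" unfolding b_def by (intro eqv_mult eqv_refl c)
      also have "\<dots> \<approx> b * (e * (1 + x * g))" by (rule eqv_left_commute)
      also have "\<dots> \<approx> b * 1" by (intro eqv_mult eqv_refl e)
      finally have "b \<approx> e * (c * a)" using eqv_sym by simp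
      then have bt: "b * t ^ n \<approx> e * (c * (a * t ^ n))"
        using eqv_mult[OF _ eqv_refl[of "t ^ n"]] by (metis mult.assoc)
      have "a * t ^ n \<in> polyspan R t n" using a(3) polyspan_mono_set[OF R(2)] by blast
      then have "e * (c * (a * t ^ n)) \<in> polyspan R t n"
        using c(1) R(2) by (intro polyspan_scale[OF R(1) e(1)] polyspan_scale[OF R(1), of c]) auto
      then have btn: "b * t ^ n \<in> polyspan R t n" using bt by (rule M_module_eqv[OF smod, rotated])
      have "n \<noteq> 0" using a(2,3) by (cases n) auto
      then obtain m where m: "n = Suc m" using not0_implies_Suc by blast
      have "b ^ m * (b * t ^ n) \<in> polyspan R (b * t) n"
        by (rule polyspan_scale_argument[OF R(1) bR btn]) (simp add: m)
      moreover have "(b * t) ^ n \<approx> b ^ m * (b * t ^ n)"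
        using eqv_power_mult[of b t n] by (simp add: m mult.assoc power_Suc2 del: power_Suc)
      ultimately have "(b * t) ^ n \<in> polyspan R (b * t) n" by (rule M_module_eqv[OF smod, rotated])
      then have "b * t \<in> R" by (rule closed)
      then have "z ^ k * (b * t) \<in> S" using S by (blast intro: subring_mult subring_power)
      moreover have "z ^ k * (b * t) \<approx> t"
      proof -
        have "z ^ k * b \<approx> (z * x) ^ k" unfolding b_def by (rule eqv_sym[OF eqv_power_mult])
        also have "\<dots> \<approx> 1 ^ k" by (rule eqv_power[OF zx])
        finally have "z ^ k * b * t \<approx> 1 ^ k * t" by (rule eqv_mult[OF _ eqv_refl])
        then show ?thesis by (simp add: mult.assoc)
      qed
      moreover have "M_subring S" using S R(1) unfolding M_subring_def by blast
      ultimately show "t \<in> S" using M_subring_eqv eqv_sym by blast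
    qed
    then show ?thesis by blast
  qed
  show ?thesis
  proof (rule maximal_subring_if_finitely_generated_extension[of R "{z}"])
    show "is_subring R" using R(1) by (simp add: M_subring_def)
    show "R \<noteq> UNIV" using R(3) by blast
    show "S = UNIV" if "is_subring S" "R \<subseteq> S" "{z} \<subseteq> S" for S
      using gen that by blast
  qed simp
qed

section \<open>Algebraicity of the residue fields\<close>

text \<open>Only finitely many coefficients occur, so one member of the chain contains them all.
  This makes transcendence pass to unions of chains.\<close>

lemma polyspan_Union_chain:
  assumes "\<C> \<noteq> {}" "subset.chain A \<C>"
  shows "u \<in> polyspan (\<Union>\<C>) t n \<Longrightarrow> \<exists>S\<in>\<C>. u \<in> polyspan S t n"
proof (induction n arbitrary: u)
  case 0
  then show ?case using assms(1) by auto
next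
  case (Suc n)
  obtain w b where 1: "u = w + b * t ^ n" "w \<in> polyspan (\<Union>\<C>) t n" "b \<in> \<Union>\<C>"
    using Suc.prems by (rule polyspan_SucE)
  obtain S where S: "S \<in> \<C>" "w \<in> polyspan S t n" using Suc.IH[OF 1(2)] by blast
  obtain T where T: "T \<in> \<C>" "b \<in> T" using 1(3) by blast
  have "S \<subseteq> T \<or> T \<subseteq> S" using assms(2) S T unfolding subset_chain_def by blast
  then show ?case
  proof
    assume "S \<subseteq> T"
    then have "w \<in> polyspan T t n" using S(2) polyspan_mono_set by blast
    then show ?thesis using polyspan_SucI[OF _ T(2)] T(1) 1(1) by blast
  next
    assume "T \<subseteq> S"
    then have "b \<in> S" using T(2) by blast
    then show ?thesis using polyspan_SucI[OF S(2)] S(1) 1(1) by blast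
  qed
qed

lemma polyspan_adjoin:
  assumes F: "M_subring F"
  shows "u \<in> polyspan (adjoin F t) x n \<Longrightarrow> \<exists>k. u \<in> polyspan (polyspan F t k) x n"
proof (induction n arbitrary: u)
  case 0
  then show ?case by simp
next
  case (Suc n)
  obtain w b where 1: "u = w + b * x ^ n" "w \<in> polyspan (adjoin F t) x n" "b \<in> adjoin F t"
    using Suc.prems by (rule polyspan_SucE)
  obtain k where k: "w \<in> polyspan (polyspan F t k) x n" using Suc.IH[OF 1(2)] by blast
  obtain l where l: "b \<in> polyspan F t l" using 1(3) by (rule adjoinE)
  note mono = polyspan_mono[OF M_subring_module[OF F], of _ "max k l" t]
  have "w \<in> polyspan (polyspan F t (max k l)) x n"
    using k polyspan_mono_set[OF mono[of k], of x n] by auto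
  moreover have "b \<in> polyspan F t (max k l)" using l mono[of l] by auto
  ultimately show ?case using polyspan_SucI 1(1) by blast
qed

lemma polyspan_swap_monom:
  assumes B: "M_module B"
  shows "b \<in> polyspan B t k \<Longrightarrow> b * x ^ n \<in> polyspan (polyspan B x (Suc n)) t k"
proof (induction k arbitrary: b)
  case 0
  then show ?case using right by simp
next
  case (Suc k)
  obtain w c where 1: "b = w + c * t ^ k" "w \<in> polyspan B t k" "c \<in> B"
    using Suc.prems by (rule polyspan_SucE)
  have "c * (t ^ k * x ^ n) \<approx> c * (x ^ n * t ^ k)" by (intro eqv_mult eqv_refl eqv_commute)
  then have "b * x ^ n \<approx> w * x ^ n + (c * x ^ n) * t ^ k"
    unfolding 1 distrib_right mult.assoc by (rule eqv_add[OF eqv_refl])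
  moreover have "w * x ^ n + (c * x ^ n) * t ^ k \<in> polyspan (polyspan B x (Suc n)) t (Suc k)"
    by (rule polyspan_SucI[OF Suc.IH[OF 1(2)] polyspan_monom[OF B 1(3)]])
  ultimately show ?case
    by (rule M_module_eqv[OF polyspan_module[OF polyspan_module[OF B]]])
qed

text \<open>Regrouping a double sum by powers of \<open>t\<close> preserves both degree bounds; it
  is possible because \<open>x\<close> and \<open>t\<close> commute modulo \<open>M\<close>.\<close>

lemma polyspan_swap:
  assumes B: "M_module B"
  shows "u \<in> polyspan (polyspan B t k) x n \<Longrightarrow> u \<in> polyspan (polyspan B x n) t k"
proof (induction n arbitrary: u)
  case 0
  then have "u \<in> M" by simp
  then show ?case by (rule M_module_M[OF polyspan_module[OF polyspan_module[OF B]]])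
next
  case (Suc n)
  obtain w b where 1: "u = w + b * x ^ n" "w \<in> polyspan (polyspan B t k) x n" "b \<in> polyspan B t k"
    using Suc.prems by (rule polyspan_SucE)
  have "w \<in> polyspan (polyspan B x (Suc n)) t k"
    using Suc.IH[OF 1(2)] polyspan_mono_set[OF polyspan_Suc_mono[OF B]] by blast
  from M_module_add[OF polyspan_module[OF polyspan_module[OF B]] this polyspan_swap_monom[OF B 1(3)]]
  show ?case unfolding 1 .
qed

lemma not_algebraicD:
  "\<not> algebraic A t \<Longrightarrow> a \<in> A \<Longrightarrow> a * t ^ n \<in> polyspan A t n \<Longrightarrow> a \<in> M"
  unfolding algebraic_def by blast

lemma algebraic_member: "M_subring A \<Longrightarrow> t \<in> A \<Longrightarrow> algebraic A t"
  unfolding algebraic_def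
  using polyspan_1[OF M_subring_module, of A t] M_subring_one[of A] one_notin
  by (intro exI[of _ "Suc 0"] bexI[of _ 1]) auto

text \<open>Steinitz exchange. If \<open>t\<close> were transcendental over \<open>F[x]\<close>, a
  relation for \<open>x\<close> over \<open>F[t]\<close> could be regrouped by powers of
  \<open>t\<close> and compared coefficientwise; each comparison is a relation for \<open>x\<close>
  over \<open>F\<close>, so the leading coefficient would lie in \<open>M\<close>.\<close>

lemma algebraic_exchange:
  assumes F: "M_subring F" and x: "\<not> algebraic F x" and alg: "algebraic (adjoin F t) x"
  shows "algebraic (adjoin F x) t"
proof (rule ccontr)
  assume nalg: "\<not> algebraic (adjoin F x) t"
  note mod = M_subring_module[OF F]
  note smod = polyspan_module[OF polyspan_module[OF mod]]
  have sub: "polyspan F x m \<subseteq> adjoin F x" for m using adjoinI by blast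
  \<comment> \<open>Induction on the degree bound in \<open>t\<close>, with \<open>c\<close> and
    \<open>p\<close> the top coefficients of the two sides. Transcendence of \<open>t\<close> over
    \<open>F[x]\<close> gives \<open>c * x ^ n = p\<close> modulo \<open>M\<close>; transcendence of
    \<open>x\<close> over \<open>F\<close> then puts \<open>c\<close> into \<open>M\<close>.\<close>
  have *: "a \<in> M" if "a \<in> polyspan F t k" "a * x ^ n \<in> polyspan (polyspan F x n) t k" for a n k
    using that
  proof (induction k arbitrary: a)
    case 0
    then show ?case by simp
  next
    case (Suc k)
    obtain a' c where a: "a = a' + c * t ^ k" "a' \<in> polyspan F t k" "c \<in> F"
      using Suc.prems(1) by (rule polyspan_SucE)
    obtain u p where u: "a * x ^ n = u + p * t ^ k" "u \<in> polyspan (polyspan F x n) t k"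
        "p \<in> polyspan F x n"
      using Suc.prems(2) by (rule polyspan_SucE)
    have cx: "c * x ^ n \<in> polyspan F x (Suc n)" by (rule polyspan_monom[OF mod a(3)])
    have p: "p \<in> polyspan F x (Suc n)" using u(3) polyspan_Suc_mono[OF mod] by blast
    have "c * (x ^ n * t ^ k) \<approx> c * (t ^ k * x ^ n)" by (intro eqv_mult eqv_refl eqv_commute)
    then have "(c * x ^ n - p) * t ^ k \<approx> c * (t ^ k * x ^ n) - p * t ^ k"
      unfolding left_diff_distrib mult.assoc by (intro eqv_diff eqv_refl)
    also have "\<dots> = u - a' * x ^ n" using u(1) by (simp add: a(1) algebra_simps)
    finally have eq: "(c * x ^ n - p) * t ^ k \<approx> u - a' * x ^ n" .
    have "u \<in> polyspan (polyspan F x (Suc n)) t k"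
      using u(2) polyspan_mono_set[OF polyspan_Suc_mono[OF mod]] by blast
    then have "u - a' * x ^ n \<in> polyspan (polyspan F x (Suc n)) t k"
      by (rule M_module_diff[OF smod _ polyspan_swap_monom[OF mod a(2)]])
    then have "(c * x ^ n - p) * t ^ k \<in> polyspan (polyspan F x (Suc n)) t k"
      by (rule M_module_eqv[OF smod eq])
    then have "(c * x ^ n - p) * t ^ k \<in> polyspan (adjoin F x) t k"
      using polyspan_mono_set[OF sub] by blast
    moreover have "c * x ^ n - p \<in> adjoin F x"
      using M_module_diff[OF polyspan_module[OF mod] cx p] sub by blast
    ultimately have cp: "c * x ^ n - p \<in> M" by (rule not_algebraicD[OF nalg, rotated])
    then have "c * x ^ n \<in> polyspan F x n"
      using M_module_eqv[OF polyspan_module[OF mod] _ u(3)] by (simp add: eqv_def)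
    then have c: "c \<in> M" by (rule not_algebraicD[OF x a(3)])
    have "p = c * x ^ n - (c * x ^ n - p)" by simp
    also have "\<dots> \<in> M" by (rule M_diff[OF right[OF c] cp])
    finally have pM: "p \<in> M" .
    have "a' * x ^ n = u + (p * t ^ k - c * t ^ k * x ^ n)" using u(1) by (simp add: a(1) algebra_simps)
    moreover have "p * t ^ k - c * t ^ k * x ^ n \<in> M" by (intro M_diff right pM c)
    ultimately have "a' * x ^ n \<in> polyspan (polyspan F x n) t k"
      using M_module_add[OF smod u(2)] M_module_M[OF smod] by simp
    then have "a' \<in> M" by (rule Suc.IH[OF a(2)])
    then show ?case unfolding a(1) by (rule M_add[OF _ right[OF c]])
  qed
  obtain n a where a: "a \<in> adjoin F t" "a \<notin> M" "a * x ^ n \<in> polyspan (adjoin F t) x n"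
    using alg unfolding algebraic_def by blast
  obtain k where k: "a \<in> polyspan F t k" using a(1) by (rule adjoinE)
  obtain l where l: "a * x ^ n \<in> polyspan (polyspan F t l) x n" using polyspan_adjoin[OF F a(3)] by blast
  have "a * x ^ n \<in> polyspan (polyspan F x n) t l" by (rule polyspan_swap[OF mod l])
  then have "a * x ^ n \<in> polyspan (polyspan F x n) t (max k l)"
    using polyspan_mono[OF polyspan_module[OF mod], of l "max k l"] by auto
  moreover have "a \<in> polyspan F t (max k l)" using k polyspan_mono[OF mod, of k "max k l"] by auto
  ultimately show False using * a(2) by blast
qed

text \<open>One power of \<open>f\<close> clears the denominators of a whole relation. The leading
  coefficient stays outside \<open>M\<close>, because \<open>M\<close> is prime and does not contain
  \<open>f\<close>.\<close>

lemma not_algebraic_localization: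
  assumes F: "M_subring F" "f \<in> F" "f \<notin> M" and x: "\<not> algebraic F x"
  shows "\<not> algebraic {y. \<exists>k. f ^ k * y \<in> F} x"
proof
  let ?L = "{y. \<exists>k. f ^ k * y \<in> F}"
  note mod = M_subring_module[OF F(1)]
  have larger: "f ^ j * y \<in> F" if "f ^ k * y \<in> F" "k \<le> j" for y j k
  proof -
    have "f ^ j * y = f ^ (j - k) * (f ^ k * y)"
      using that(2) by (simp flip: mult.assoc power_add)
    also have "\<dots> \<in> F" by (rule M_subring_mult[OF F(1) M_subring_power[OF F(1,2)] that(1)])
    finally show ?thesis .
  qed
  \<comment> \<open>Covering all exponents from some \<open>k\<close> on lets the bounds for
    separate terms be combined by a maximum.\<close>
  have clear: "\<exists>k. \<forall>j\<ge>k. f ^ j * u \<in> polyspan F x n" if "u \<in> polyspan ?L x n" for u n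
    using that
  proof (induction n arbitrary: u)
    case 0
    then show ?case using M_left by simp
  next
    case (Suc n)
    obtain w b where 1: "u = w + b * x ^ n" "w \<in> polyspan ?L x n" "b \<in> ?L"
      using Suc.prems by (rule polyspan_SucE)
    obtain k where k: "\<forall>j\<ge>k. f ^ j * w \<in> polyspan F x n" using Suc.IH[OF 1(2)] by blast
    obtain l where l: "f ^ l * b \<in> F" using 1(3) by blast
    have "f ^ j * u \<in> polyspan F x (Suc n)" if j: "j \<ge> max k l" for j
    proof -
      have "f ^ j * u = f ^ j * w + (f ^ j * b) * x ^ n" by (simp add: 1 algebra_simps)
      also have "\<dots> \<in> polyspan F x (Suc n)"
        using k larger[OF l] j by (intro polyspan_SucI) auto
      finally show ?thesis .
    qed
    then show ?case by blast
  qed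
  assume "algebraic ?L x"
  then obtain n a where a: "a \<in> ?L" "a \<notin> M" "a * x ^ n \<in> polyspan ?L x n"
    unfolding algebraic_def by blast
  obtain k where k: "\<forall>j\<ge>k. f ^ j * (a * x ^ n) \<in> polyspan F x n" using clear[OF a(3)] by blast
  obtain l where l: "f ^ l * a \<in> F" using a(1) by blast
  have "f ^ max k l * a * x ^ n \<in> polyspan F x n" using k by (simp add: mult.assoc)
  then have "f ^ max k l * a \<in> M"
    using larger[OF l, of "max k l"] by (intro not_algebraicD[OF x]) auto
  then show False using prime power_notin[OF F(3)] a(2) by blast
qed

text \<open>While \<open>polyspan\<close> is built by adding top terms, factoring out powers of
  \<open>x\<close> requires splitting off the constant term \<open>f\<close>.\<close>

lemma polyspan_low:
  assumes F: "M_module F"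
  shows "a \<in> polyspan F x (Suc n) \<Longrightarrow> \<exists>f\<in>F. \<exists>g\<in>polyspan F x n. a \<approx> f + x * g"
proof (induction n arbitrary: a)
  case 0
  then obtain w b where 1: "a = w + b" "w \<in> M" "b \<in> F" by auto
  then have "a \<approx> b + x * 0" by (simp add: eqv_def)
  then show ?case using 1(3) by (intro bexI[of _ b] bexI[of _ 0]) (simp_all add: M_zero)
next
  case (Suc n)
  obtain w b where 1: "a = w + b * x ^ Suc n" "w \<in> polyspan F x (Suc n)" "b \<in> F"
    using Suc.prems by (rule polyspan_SucE)
  obtain f g where fg: "f \<in> F" "g \<in> polyspan F x n" "w \<approx> f + x * g" using Suc.IH[OF 1(2)] by blast
  have "b * (x * x ^ n) \<approx> x * (b * x ^ n)" by (rule eqv_left_commute)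
  then have "a \<approx> (f + x * g) + x * (b * x ^ n)"
    unfolding 1 power_Suc by (rule eqv_add[OF fg(3)])
  also have "\<dots> = f + x * (g + b * x ^ n)" by (simp add: algebra_simps)
  finally have "a \<approx> f + x * (g + b * x ^ n)" .
  then show ?case using fg(1) polyspan_SucI[OF fg(2) 1(3)] by blast
qed

text \<open>For a subring \<open>F\<close> maximal among those over which \<open>x\<close> is transcendental modulo \<open>M\<close>,
  \<open>F/M\<close> is a field and \<open>T/M\<close> is algebraic over the polynomial ring \<open>(F/M)[x]\<close>.\<close>
lemma maximal_subring_if_transcendental:
  assumes x: "\<not> algebraic (int_plus M) x"
  shows "has_maximal_subring TYPE('a)"
proof -
  have Z: "M_subring (int_plus M)"
    unfolding M_subring_def using subset_int_plus subring_int_plus[OF left] by blast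
  obtain F where F: "M_subring F" "int_plus M \<subseteq> F" "\<not> algebraic F x"
    and max: "\<And>S. M_subring S \<Longrightarrow> F \<subseteq> S \<Longrightarrow> \<not> algebraic S x \<Longrightarrow> S = F"
  proof (rule ex_maximal_M_subring[OF Z, of "\<lambda>S. \<not> algebraic S x"])
    show "\<not> algebraic (int_plus M) x" by (rule x)
    fix \<C> assume ne: "\<C> \<noteq> {}"
      and C: "subset.chain {S. M_subring S \<and> int_plus M \<subseteq> S \<and> \<not> algebraic S x} \<C>"
    show "\<not> algebraic (\<Union>\<C>) x"
    proof
      assume "algebraic (\<Union>\<C>) x"
      then obtain n a where a: "a \<in> \<Union>\<C>" "a \<notin> M" "a * x ^ n \<in> polyspan (\<Union>\<C>) x n"
        unfolding algebraic_def by blast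
      obtain S where S: "S \<in> \<C>" "a * x ^ n \<in> polyspan S x n"
        using polyspan_Union_chain[OF ne C a(3)] by blast
      obtain T where T: "T \<in> \<C>" "a \<in> T" using a(1) by blast
      have "S \<subseteq> T \<or> T \<subseteq> S" using C S T unfolding subset_chain_def by blast
      then have "algebraic S x \<or> algebraic T x"
        unfolding algebraic_def using a(2) S(2) T(2) polyspan_mono_set by blast
      then show False using C S T unfolding subset_chain_def by blast
    qed
  qed blast
  note mod = M_subring_module[OF F(1)]
  note smod = polyspan_module[OF mod]
  let ?A = "adjoin F x"
  have A: "M_subring ?A" by (rule M_subring_adjoin[OF F(1)])
  \<comment> \<open>Localizing \<open>F\<close> at \<open>f\<close> keeps \<open>x\<close>
    transcendental, so by maximality it adds nothing to \<open>F\<close>. Thus \<open>F/M\<close> is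
    a field.\<close>
  have inverse: "\<exists>c\<in>F. c * f \<approx> 1" if f: "f \<in> F" "f \<notin> M" for f
  proof -
    obtain c where c: "c * f - 1 \<in> M" "f * c - 1 \<in> M" using two_sided_inverse[OF f(2)] by blast
    have "{y. \<exists>k. f ^ k * y \<in> F} = F"
    proof (rule max[OF M_subring_localization[OF F(1) f(1)] _ not_algebraic_localization[OF F(1) f F(3)]])
      show "F \<subseteq> {y. \<exists>k. f ^ k * y \<in> F}" by (auto intro!: exI[of _ 0])
    qed
    moreover have "f ^ 1 * c \<in> F"
      using M_subring_eqv[OF F(1), of "f * c" 1] c(2) M_subring_one[OF F(1)] by (simp add: eqv_def)
    ultimately have "c \<in> F" by blast
    then show ?thesis using c(1) unfolding eqv_def by blast
  qed
  have "x \<notin> M"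
  proof
    assume "x \<in> M"
    then have "algebraic F x" by (intro algebraic_member F M_subring_M[OF F(1)])
    then show False using F(3) by blast
  qed
  then obtain z where z: "x * z \<approx> 1" using two_sided_inverse unfolding eqv_def by blast
  \<comment> \<open>Transcendence of \<open>x\<close> removes the coefficients of \<open>w\<close>
    from the top downwards, until only \<open>c\<close> is left. With \<open>c = - 1\<close> this
    shows that \<open>x\<close> has no inverse in \<open>F[x]\<close> modulo
    \<open>M\<close>.\<close>
  have no_inverse: "c \<in> M" if "w \<in> polyspan F x n" "c \<in> F" "x * w + c \<in> M" for w c n
    using that
  proof (induction n arbitrary: w)
    case 0
    then have "x * w \<in> M" using M_left by simp
    then show ?case using M_diff[OF 0(3)] by fastforce
  next
    case (Suc n)
    obtain v b where 1: "w = v + b * x ^ n" "v \<in> polyspan F x n" "b \<in> F"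
      using Suc.prems(1) by (rule polyspan_SucE)
    have "b * (x * x ^ n) \<approx> x * (b * x ^ n)" by (rule eqv_left_commute)
    also have "x * (b * x ^ n) = (x * w + c) - (x * v + c)" by (simp add: 1 algebra_simps)
    also have "\<dots> \<approx> 0 - (x * v + c)"
      using Suc.prems(3) by (intro eqv_diff eqv_refl) (simp add: eqv_zero)
    finally have eq: "b * x ^ Suc n \<approx> 0 - (x * v + c)" by simp
    have "polyspan F x (Suc 0) \<subseteq> polyspan F x (Suc n)" by (rule polyspan_mono[OF mod]) simp
    then have "c \<in> polyspan F x (Suc n)" using polyspan_1[OF mod, of x] Suc.prems(2) by blast
    then have "0 - (x * v + c) \<in> polyspan F x (Suc n)"
      by (intro M_module_diff[OF smod] M_module_add[OF smod] M_module_zero[OF smod]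
          polyspan_shift[OF mod 1(2)])
    then have "b * x ^ Suc n \<in> polyspan F x (Suc n)" by (rule M_module_eqv[OF smod eq])
    then have b: "b \<in> M" by (rule not_algebraicD[OF F(3) 1(3)])
    have "x * v + c = (x * w + c) - x * (b * x ^ n)" by (simp add: 1 algebra_simps)
    also have "\<dots> \<in> M" by (intro M_diff Suc.prems M_left right b)
    finally show ?case by (rule Suc.IH[OF 1(2) Suc.prems(2)])
  qed
  show ?thesis
  proof (rule maximal_subring_if_divided[OF A adjoin_self[OF F(1)] _ z])
    show "z \<notin> ?A"
    proof
      assume "z \<in> ?A"
      then obtain n where "z \<in> polyspan F x n" by (rule adjoinE)
      moreover have "- 1 \<in> F" by (intro M_subring_uminus[OF F(1)] M_subring_one[OF F(1)])
      moreover have "x * z + - 1 \<in> M" using z by (simp add: eqv_def)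
      ultimately have "- 1 \<in> M" by (rule no_inverse)
      then show False using M_uminus[of "- 1"] one_notin by simp
    qed
    show "algebraic ?A t" for t
    proof (cases "t \<in> F")
      case True
      then show ?thesis using algebraic_member[OF A] subset_adjoin[OF F(1)] by blast
    next
      case False
      \<comment> \<open>For \<open>t\<close> outside \<open>F\<close>, maximality of
        \<open>F\<close> makes \<open>x\<close> algebraic over \<open>F[t]\<close>; the exchange
        property turns this into algebraicity of \<open>t\<close> over \<open>F[x]\<close>.\<close>
      have "algebraic (adjoin F t) x"
      proof (rule ccontr)
        assume "\<not> algebraic (adjoin F t) x"
        then have "adjoin F t = F" by (rule max[OF M_subring_adjoin[OF F(1)] subset_adjoin[OF F(1)]])
        then show False using adjoin_self[OF F(1)] False by blast
      qed
      then show ?thesis by (rule algebraic_exchange[OF F(1,3)])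
    qed
    \<comment> \<open>Over the field \<open>F/M\<close> a nonzero polynomial is a power of
      \<open>x\<close> times one with nonzero constant term, which the factor \<open>c\<close>
      normalizes to 1.\<close>
    have divided: "\<exists>c\<in>?A. \<exists>k. \<exists>g\<in>?A. c * a \<approx> x ^ k * (1 + x * g)"
      if "a \<in> polyspan F x n" "a \<notin> M" for a n
      using that
    proof (induction n arbitrary: a)
      case 0
      then show ?case by simp
    next
      case (Suc n)
      obtain f g where fg: "f \<in> F" "g \<in> polyspan F x n" "a \<approx> f + x * g"
        using polyspan_low[OF mod Suc.prems(1)] by blast
      have gA: "g \<in> ?A" using fg(2) by (rule adjoinI)
      show ?case
      proof (cases "f \<in> M")
        case True
        then have "f + x * g \<approx> 0 + x * g" by (intro eqv_add eqv_refl) (simp add: eqv_zero)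
        with fg(3) have a: "a \<approx> x * g" using eqv_trans by fastforce
        then have "g \<notin> M" using Suc.prems(2) M_cong M_left unfolding eqv_def by blast
        then obtain c k h where c: "c \<in> ?A" "h \<in> ?A" "c * g \<approx> x ^ k * (1 + x * h)"
          using Suc.IH[OF fg(2)] by blast
        have "c * a \<approx> c * (x * g)" by (rule eqv_mult[OF eqv_refl a])
        also have "\<dots> \<approx> x * (c * g)" by (rule eqv_left_commute)
        also have "\<dots> \<approx> x * (x ^ k * (1 + x * h))" by (rule eqv_mult[OF eqv_refl c(3)])
        also have "\<dots> = x ^ Suc k * (1 + x * h)" by (simp add: mult.assoc)
        finally show ?thesis using c(1,2) by blast
      next
        case False
        then obtain c where c: "c \<in> F" "c * f \<approx> 1" using inverse[OF fg(1)] by blast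
        have cA: "c \<in> ?A" using c(1) subset_adjoin[OF F(1)] by blast
        have "c * a \<approx> c * (f + x * g)" by (rule eqv_mult[OF eqv_refl fg(3)])
        also have "\<dots> = c * f + c * (x * g)" by (rule distrib_left)
        also have "\<dots> \<approx> 1 + x * (c * g)" by (rule eqv_add[OF c(2) eqv_left_commute])
        finally have "c * a \<approx> x ^ 0 * (1 + x * (c * g))" by simp
        then show ?thesis using cA M_subring_mult[OF A cA gA] by blast
      qed
    qed
    show "\<exists>c\<in>?A. \<exists>k. \<exists>g\<in>?A. c * a \<approx> x ^ k * (1 + x * g)" if "a \<in> ?A" "a \<notin> M" for a
      using that divided by (meson adjoinE)
  qed
qed

text \<open>This is \<open>maximal_subring_if_divided\<close> over the integers with
  \<open>x = 2\<close> and \<open>z\<close> the inverse of 2: a nonzero integer is a power of 2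
  times an odd number \<open>1 + 2 * g\<close>.\<close>

lemma maximal_subring_if_char_0:
  assumes char: "\<And>k. k \<noteq> 0 \<Longrightarrow> of_int k \<notin> M" and alg: "\<And>t. algebraic (int_plus M) t"
  shows "has_maximal_subring TYPE('a)"
proof -
  let ?A = "int_plus M"
  have A: "M_subring ?A"
    unfolding M_subring_def using subset_int_plus subring_int_plus[OF left] by blast
  have int: "of_int k \<in> ?A" for k using int_plusI[OF M_zero, of k] by simp
  obtain z where z: "of_int 2 * z \<approx> 1"
    using two_sided_inverse[OF char[of 2]] unfolding eqv_def by auto
  have decompose: "\<exists>j g. k = 2 ^ j * (1 + 2 * g)" if "k \<noteq> 0" for k :: int
    using that
  proof (induction "nat \<bar>k\<bar>" arbitrary: k rule: less_induct)
    case less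
    show ?case
    proof (cases "even k")
      case True
      then obtain l where l: "k = 2 * l" by blast
      have "nat \<bar>l\<bar> < nat \<bar>k\<bar>" "l \<noteq> 0" using l less.prems by linarith+
      then obtain j g where "l = 2 ^ j * (1 + 2 * g)" using less.hyps[of l] by blast
      then have "k = 2 ^ Suc j * (1 + 2 * g)" using l by simp
      then show ?thesis by blast
    next
      case False
      then obtain g where "k = 2 * g + 1" by (rule oddE)
      then have "k = 2 ^ 0 * (1 + 2 * g)" by simp
      then show ?thesis by blast
    qed
  qed
  show ?thesis
  proof (rule maximal_subring_if_divided[OF A int _ z])
    show "z \<notin> ?A"
    proof
      assume "z \<in> ?A"
      then obtain k m where km: "z = of_int k + m" "m \<in> M" by (rule int_plusE)
      \<comment> \<open>If the inverse of 2 were congruent to an integer \<open>k\<close>, the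
        nonzero integer \<open>2 * k - 1\<close> would lie in \<open>M\<close>.\<close>
      have "of_int (2 * k - 1) = (of_int 2 * z - 1) - of_int 2 * m" by (simp add: km distrib_left)
      also have "\<dots> \<in> M" by (rule M_diff[OF z[unfolded eqv_def] M_left[OF km(2)]])
      finally have "2 * k - 1 = 0" using char by blast
      then show False by presburger
    qed
    show "algebraic ?A t" for t by (rule alg)
    fix a assume a: "a \<in> ?A" "a \<notin> M"
    obtain k m where km: "a = of_int k + m" "m \<in> M" using a(1) by (rule int_plusE)
    then have "k \<noteq> 0" using a(2) by auto
    then obtain j g where jg: "k = 2 ^ j * (1 + 2 * g)" using decompose by blast
    have "1 * a \<approx> of_int 2 ^ j * (1 + of_int 2 * of_int g)"
      unfolding eqv_def km jg using km(2) by simp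
    then show "\<exists>c\<in>?A. \<exists>k. \<exists>g\<in>?A. c * a \<approx> of_int 2 ^ k * (1 + of_int 2 * g)"
      using int[of 1] int[of g] unfolding of_int_1 by blast
  qed
qed

end

section \<open>Integer polynomials and countability\<close>

text \<open>Horner's scheme at an element of a possibly noncommutative ring. Integer coefficients
  are central, so evaluation still respects products.\<close>

definition int_poly_eval :: "int poly \<Rightarrow> 'a::ring_1 \<Rightarrow> 'a" where
  "int_poly_eval p x = fold_coeffs (\<lambda>c v. of_int c + x * v) p 0"

lemma int_poly_eval_0 [simp]: "int_poly_eval 0 x = 0"
  by (simp add: int_poly_eval_def)

lemma int_poly_eval_pCons [simp]:
  "int_poly_eval (pCons c p) x = of_int c + x * int_poly_eval p x"
  by (cases "c = 0 \<and> p = 0") (auto simp: int_poly_eval_def fold_coeffs_pCons_not_0_0_eq)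

lemma int_poly_eval_1 [simp]: "int_poly_eval 1 x = 1"
  by (simp add: one_pCons)

lemma int_poly_eval_add: "int_poly_eval (p + q) x = int_poly_eval p x + int_poly_eval q x"
  by (induction p q rule: poly_induct2) (simp_all add: algebra_simps)

lemma int_poly_eval_smult: "int_poly_eval (smult c p) x = of_int c * int_poly_eval p x"
proof (induction p)
  case (pCons a p)
  have "x * (of_int c * int_poly_eval p x) = of_int c * (x * int_poly_eval p x)"
    using mult_of_int_commute[of c x] by (metis mult.assoc)
  then show ?case using pCons by (simp add: distrib_left)
qed simp

lemma int_poly_eval_diff: "int_poly_eval (p - q) x = int_poly_eval p x - int_poly_eval q x"
  using int_poly_eval_add[of "p - q" q x] by simp

lemma int_poly_eval_mult: "int_poly_eval (p * q) x = int_poly_eval p x * int_poly_eval q x"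
  by (induction p) (simp_all add: int_poly_eval_add int_poly_eval_smult distrib_right mult.assoc)

lemma int_poly_eval_monom: "int_poly_eval (monom c n) x = of_int c * x ^ n"
proof (induction n)
  case (Suc n)
  then show ?case using mult_of_int_commute[of c x] by (simp add: monom_Suc) (metis mult.assoc)
qed (simp add: monom_0)

lemma int_poly_eval_sum: "int_poly_eval (\<Sum>i\<in>I. f i) x = (\<Sum>i\<in>I. int_poly_eval (f i) x)"
  by (induction I rule: infinite_finite_induct) (simp_all add: int_poly_eval_add)

lemma int_poly_eval_altdef: "int_poly_eval p x = (\<Sum>i\<le>degree p. of_int (coeff p i) * x ^ i)"
proof -
  have "int_poly_eval (\<Sum>i\<le>degree p. monom (coeff p i) i) x
      = (\<Sum>i\<le>degree p. of_int (coeff p i) * x ^ i)"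
    by (simp add: int_poly_eval_sum int_poly_eval_monom)
  then show ?thesis by (simp only: poly_as_sum_of_monoms)
qed

lemma integral_over_prime_subring:
  fixes x :: "'a::ring_1"
  assumes "lead_coeff p = 1" "int_poly_eval p x = 0"
  shows "integral_over prime_subring x"
  unfolding integral_over_def
proof (intro exI conjI allI impI)
  show "of_int (coeff p i) \<in> (prime_subring :: 'a set)" for i
    by (simp add: prime_subring_def)
  \<comment> \<open>A monic polynomial of degree 0 is 1 and has no root.\<close>
  have "degree p \<noteq> 0"
  proof
    assume "degree p = 0"
    then obtain c where "p = [:c:]" by (rule degree_eq_zeroE)
    then show False using assms by simp
  qed
  then show "1 \<le> degree p" by simp
  show "x ^ degree p + (\<Sum>i<degree p. of_int (coeff p i) * x ^ i) = 0"
    using assms by (simp add: int_poly_eval_altdef lessThan_Suc_atMost[symmetric] add.commute)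
qed

lemma countable_int_poly: "countable (UNIV :: int poly set)"
proof -
  have "inj (coeffs :: int poly \<Rightarrow> int list)" by (rule injI) (simp add: coeffs_eq_iff)
  then show ?thesis by (rule countableI'[OF inj_compose[OF inj_to_nat], simplified])
qed

text \<open>The left ideals for which the conclusion of the theorem holds modulo \<open>L\<close>.\<close>
definition small_quotient :: "'a::ring_1 set \<Rightarrow> bool" where
  "small_quotient L \<longleftrightarrow> left_ideal L \<and> (\<exists>C. countable C \<and> (\<forall>t. \<exists>c\<in>C. t - c \<in> L)) \<and>
     (\<exists>n>0. of_nat n \<in> L) \<and> (\<forall>t. \<exists>p. lead_coeff p = 1 \<and> int_poly_eval p t \<in> L)"

section \<open>Roots of monic polynomials and smallness of residue fields\<close>

context residue_field
begin

text \<open>Monic polynomial functions of degree \<open>n\<close> over T/M in Horner form. Their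
  coefficients range over T because division by \<open>x - r\<close> leaves the integer
  polynomials.\<close>

primrec monic_function :: "nat \<Rightarrow> ('a \<Rightarrow> 'a) \<Rightarrow> bool" where
  "monic_function 0 g \<longleftrightarrow> (\<forall>x. g x \<approx> 1)"
| "monic_function (Suc n) g \<longleftrightarrow> (\<exists>h c. monic_function n h \<and> (\<forall>x. g x \<approx> x * h x + c))"

text \<open>The factor theorem, by induction along Horner's scheme:
  \<open>x * h x - r * h r = x * (h x - h r) + (x - r) * h r\<close>.\<close>

lemma monic_function_split_root:
  "monic_function (Suc n) g \<Longrightarrow> \<exists>h. monic_function n h \<and> (\<forall>x. g x - g r \<approx> (x - r) * h x)"
proof (induction n arbitrary: g)
  case 0
  then obtain h c where h: "\<And>x. h x \<approx> 1" "\<And>x. g x \<approx> x * h x + c" by auto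
  have "g x - g r \<approx> (x - r) * 1" for x
  proof -
    have "g x - g r \<approx> (x * h x + c) - (r * h r + c)" by (intro eqv_diff h)
    also have "\<dots> \<approx> (x * 1 + c) - (r * 1 + c)" by (intro eqv_diff eqv_add eqv_mult eqv_refl h)
    finally show ?thesis by simp
  qed
  then show ?case by (intro exI[of _ "\<lambda>_. 1"]) simp
next
  case (Suc n)
  obtain h c where h: "monic_function (Suc n) h" "\<And>x. g x \<approx> x * h x + c"
    using Suc.prems by (metis monic_function.simps(2))
  obtain k where k: "monic_function n k" "\<And>x. h x - h r \<approx> (x - r) * k x"
    using Suc.IH[OF h(1)] by blast
  have "g x - g r \<approx> (x - r) * (x * k x + h r)" for x
  proof -
    have "g x - g r \<approx> (x * h x + c) - (r * h r + c)" by (intro eqv_diff h)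
    also have "\<dots> = x * (h x - h r) + (x - r) * h r" by (simp add: algebra_simps)
    also have "\<dots> \<approx> x * ((x - r) * k x) + (x - r) * h r"
      by (intro eqv_add eqv_mult eqv_refl k)
    also have "\<dots> \<approx> (x - r) * (x * k x) + (x - r) * h r"
      by (intro eqv_add eqv_refl eqv_left_commute)
    finally show ?thesis by (simp add: distrib_left)
  qed
  moreover have "monic_function (Suc n) (\<lambda>x. x * k x + h r)"
    unfolding monic_function.simps using k(1) eqv_refl by blast
  ultimately show ?case by blast
qed

text \<open>A root \<open>r\<close> splits off a factor \<open>x - r\<close>. Since \<open>M\<close>
  is prime, any other root is congruent to \<open>r\<close> or is a root of the cofactor.\<close>

lemma finite_roots:
  "monic_function n g \<Longrightarrow> \<exists>C. finite C \<and> (\<forall>x. g x \<in> M \<longrightarrow> (\<exists>c\<in>C. x - c \<in> M))"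
proof (induction n arbitrary: g)
  case 0
  have "g x \<notin> M" for x
  proof
    assume "g x \<in> M"
    moreover have "g x - 1 \<in> M" using 0 by (simp add: eqv_def)
    ultimately show False using M_cong one_notin by blast
  qed
  then show ?case by blast
next
  case (Suc n)
  show ?case
  proof (cases "\<exists>r. g r \<in> M")
    case True
    then obtain r where r: "g r \<in> M" by blast
    obtain h where h: "monic_function n h" "\<And>x. g x - g r \<approx> (x - r) * h x"
      using monic_function_split_root[OF Suc.prems] by blast
    obtain C where C: "finite C" "\<And>x. h x \<in> M \<Longrightarrow> \<exists>c\<in>C. x - c \<in> M"
      using Suc.IH[OF h(1)] by blast
    have "\<exists>c\<in>insert r C. x - c \<in> M" if x: "g x \<in> M" for x
    proof -
      have "(x - r) * h x \<in> M" using M_diff[OF x r] h(2)[of x] M_cong unfolding eqv_def by blast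
      then show ?thesis using prime C(2) by blast
    qed
    then show ?thesis using C(1) by blast
  qed blast
qed

lemma monic_function_int_poly_eval:
  "lead_coeff p = 1 \<Longrightarrow> monic_function (degree p) (int_poly_eval p)"
proof (induction p)
  case (pCons c p)
  show ?case
  proof (cases "p = 0")
    case True
    then show ?thesis using pCons.prems by simp
  next
    case False
    then have "monic_function (degree p) (int_poly_eval p)" using pCons by simp
    moreover have "int_poly_eval (pCons c p) x \<approx> x * int_poly_eval p x + of_int c" for x
      by (simp add: add.commute)
    ultimately show ?thesis using False by auto
  qed
qed simp

lemma polyspan_int_poly:
  "u \<in> polyspan (int_plus M) t n \<Longrightarrow> \<exists>p. (\<forall>i\<ge>n. coeff p i = 0) \<and> int_poly_eval p t \<approx> u"
proof (induction n arbitrary: u)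
  case 0
  then show ?case by (intro exI[of _ 0]) (simp add: eqv_sym eqv_zero)
next
  case (Suc n)
  obtain w b where 1: "u = w + b * t ^ n" "w \<in> polyspan (int_plus M) t n" "b \<in> int_plus M"
    using Suc.prems by (rule polyspan_SucE)
  obtain p where p: "\<forall>i\<ge>n. coeff p i = 0" "int_poly_eval p t \<approx> w" using Suc.IH[OF 1(2)] by blast
  obtain k m where km: "b = of_int k + m" "m \<in> M" using 1(3) by (rule int_plusE)
  have "of_int k \<approx> b" using M_uminus[OF km(2)] by (simp add: eqv_def km)
  then have "int_poly_eval (p + monom k n) t \<approx> u"
    unfolding int_poly_eval_add int_poly_eval_monom 1 by (intro eqv_add eqv_mult eqv_refl p)
  moreover have "\<forall>i\<ge>Suc n. coeff (p + monom k n) i = 0" using p(1) by simp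
  ultimately show ?case by blast
qed

text \<open>Let \<open>q\<close> be the least positive integer in \<open>M\<close>. If
  \<open>g = gcd k q\<close> exceeded 1, primeness of \<open>M\<close> would put the smaller integer
  \<open>q / g\<close> into \<open>M\<close>; so \<open>g = 1\<close>, and Bezout's identity gives
  the inverse.\<close>

lemma ex_int_inverse:
  assumes char: "n > 0" "of_nat n \<in> M" and k: "of_int k \<notin> M"
  shows "\<exists>l. of_int l * of_int k \<approx> 1"
proof -
  define q where "q = (LEAST q. q > 0 \<and> of_nat q \<in> M)"
  have q: "q > 0" "of_nat q \<in> M"
    unfolding q_def using LeastI[of "\<lambda>q. q > 0 \<and> of_nat q \<in> M" n] char by blast+
  have least: "q \<le> m" if "m > 0" "of_nat m \<in> M" for m
    unfolding q_def using that by (intro Least_le) simp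
  define g where "g = gcd k (int q)"
  obtain l v where bezout: "l * k + v * int q = g" using bezout_int[of k "int q"] unfolding g_def by blast
  have "g dvd k" "g dvd int q" "g > 0" using q(1) by (auto simp: g_def)
  then obtain k' q' where kq: "k = g * k'" "int q = g * q'" by (meson dvdE)
  have "q' > 0" using kq(2) q(1) \<open>g > 0\<close> by (metis of_nat_0_less_iff zero_less_mult_pos)
  have "of_int g \<notin> M" using k right[of "of_int g"] unfolding kq(1) of_int_mult by blast
  moreover have "of_int g * of_int q' \<in> M" using q(2) kq(2) by (metis of_int_mult of_int_of_nat_eq)
  ultimately have "of_int q' \<in> M" using prime by blast
  then have "q \<le> nat q'" using least[of "nat q'"] \<open>q' > 0\<close> by simp
  then have "g * q' \<le> 1 * q'" using kq(2) \<open>q' > 0\<close> by linarith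
  then have "g = 1" using \<open>q' > 0\<close> \<open>g > 0\<close> by (simp add: mult_le_cancel_right)
  have "of_int l * of_int k + of_int v * of_nat q = (1 :: 'a)"
    using arg_cong[OF bezout, of "of_int :: int \<Rightarrow> 'a"] \<open>g = 1\<close> by simp
  then have "of_int l * of_int k - 1 = - (of_int v * of_nat q :: 'a)"
    by (simp add: eq_neg_iff_add_eq_0 diff_add_eq)
  then show ?thesis using M_uminus[OF M_left[OF q(2), of "of_int v"]] unfolding eqv_def by metis
qed

lemma small_quotient_residue_field:
  assumes "\<not> has_maximal_subring TYPE('a)"
  shows "small_quotient M"
proof -
  have alg: "algebraic (int_plus M) t" for t
    using maximal_subring_if_transcendental assms by blast
  obtain k where k: "k \<noteq> 0" "of_int k \<in> M"
    using maximal_subring_if_char_0[OF _ alg] assms by blast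
  obtain n where n: "n > 0" "of_nat n \<in> M"
  proof (cases k rule: int_cases2)
    case (nonneg n)
    then show ?thesis using k that by simp
  next
    case (nonpos n)
    then show ?thesis using k M_uminus[OF k(2)] that by simp
  qed
  have monic: "\<exists>p. lead_coeff p = 1 \<and> int_poly_eval p t \<in> M" for t
  proof -
    obtain d a where a: "a \<in> int_plus M" "a \<notin> M" "a * t ^ d \<in> polyspan (int_plus M) t d"
      using alg[of t] unfolding algebraic_def by blast
    obtain p where p: "\<forall>i\<ge>d. coeff p i = 0" "int_poly_eval p t \<approx> a * t ^ d"
      using polyspan_int_poly[OF a(3)] by blast
    obtain k m where km: "a = of_int k + m" "m \<in> M" using a(1) by (rule int_plusE)
    \<comment> \<open>The leading coefficient is congruent to an integer, which has an integer
      inverse \<open>l\<close>; scaling by \<open>l\<close> makes the relation monic.\<close>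
    have "of_int k \<notin> M" using a(2) M_add km by blast
    then obtain l where l: "of_int l * of_int k \<approx> 1" using ex_int_inverse[OF n] by blast
    have ak: "a \<approx> of_int k" using km by (simp add: eqv_def)
    have "of_int l * int_poly_eval p t \<approx> of_int l * (a * t ^ d)" by (intro eqv_mult eqv_refl p)
    also have "\<dots> \<approx> of_int l * (of_int k * t ^ d)" by (rule eqv_mult[OF eqv_refl eqv_mult[OF ak eqv_refl]])
    also have "\<dots> = of_int l * of_int k * t ^ d" by (simp add: mult.assoc)
    also have "\<dots> \<approx> 1 * t ^ d" by (rule eqv_mult[OF l eqv_refl])
    finally have "t ^ d \<approx> of_int l * int_poly_eval p t" using eqv_sym by simp
    then have "int_poly_eval (monom 1 d - smult l p) t \<in> M"
      by (simp add: int_poly_eval_diff int_poly_eval_monom int_poly_eval_smult eqv_def)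
    moreover have "degree (monom 1 d - smult l p) = d"
      using p(1) by (intro antisym degree_le le_degree) auto
    then have "lead_coeff (monom 1 d - smult l p) = 1" using p(1) by simp
    ultimately show ?thesis by blast
  qed
  have "\<exists>C. countable C \<and> (\<forall>t. \<exists>c\<in>C. t - c \<in> M)"
  proof -
    \<comment> \<open>Every element is a root modulo \<open>M\<close> of one of countably many monic
      integer polynomials, each with finitely many roots up to congruence.\<close>
    let ?P = "{p :: int poly. lead_coeff p = 1}"
    have "\<forall>p\<in>?P. \<exists>C. finite C \<and> (\<forall>x. int_poly_eval p x \<in> M \<longrightarrow> (\<exists>c\<in>C. x - c \<in> M))"
      using finite_roots[OF monic_function_int_poly_eval] by blast
    then obtain C where C: "\<And>p. p \<in> ?P \<Longrightarrow> finite (C p)"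
      "\<And>p x. p \<in> ?P \<Longrightarrow> int_poly_eval p x \<in> M \<Longrightarrow> \<exists>c\<in>C p. x - c \<in> M"
      by metis
    have "countable ?P" by (rule countable_subset[OF subset_UNIV countable_int_poly])
    then have "countable (\<Union>p\<in>?P. C p)" using C(1) by (auto intro: countable_UN countable_finite)
    moreover have "\<exists>c\<in>(\<Union>p\<in>?P. C p). t - c \<in> M" for t
      using monic[of t] C(2) by fastforce
    ultimately show ?thesis by blast
  qed
  then show ?thesis unfolding small_quotient_def using left n monic by blast
qed

end

section \<open>Products of left ideals\<close>

text \<open>Finite sums of products, that is, the usual product of left ideals. If \<open>A\<close>
  is a left ideal, negatives arise by absorbing -1 into the factors from \<open>A\<close>.\<close>

inductive_set mult_span :: "'a::ring_1 set \<Rightarrow> 'a set \<Rightarrow> 'a set" for A B where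
  zero: "0 \<in> mult_span A B"
| step: "x \<in> mult_span A B \<Longrightarrow> a \<in> A \<Longrightarrow> b \<in> B \<Longrightarrow> x + a * b \<in> mult_span A B"

lemma mult_span_base: "a \<in> A \<Longrightarrow> b \<in> B \<Longrightarrow> a * b \<in> mult_span A B"
  using mult_span.step[OF mult_span.zero] by fastforce

lemma mult_span_add:
  assumes "y \<in> mult_span A B" "x \<in> mult_span A B" shows "x + y \<in> mult_span A B"
  using assms(1)
  by induction (use assms(2) in \<open>auto simp: add.assoc[symmetric] intro: mult_span.step\<close>)

lemma mult_span_left_mult:
  assumes "left_ideal A" "x \<in> mult_span A B" shows "r * x \<in> mult_span A B"
  using assms(2)
  by induction (use left_ideal_mult[OF assms(1)] in
      \<open>auto simp: distrib_left mult.assoc[symmetric] intro: mult_span.intros\<close>)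

lemma left_ideal_mult_span:
  assumes "left_ideal A" shows "left_ideal (mult_span A B)"
  unfolding left_ideal_def
proof (intro conjI ballI allI)
  show "r * x \<in> mult_span A B" if "x \<in> mult_span A B" for r x
    by (rule mult_span_left_mult[OF assms that])
  show "x - y \<in> mult_span A B" if "x \<in> mult_span A B" "y \<in> mult_span A B" for x y
    using mult_span_add[OF mult_span_left_mult[OF assms that(2), of "- 1"] that(1)] by simp
qed (rule mult_span.zero)

lemma mult_span_least:
  assumes "left_ideal I" "\<And>a b. a \<in> A \<Longrightarrow> b \<in> B \<Longrightarrow> a * b \<in> I" shows "mult_span A B \<subseteq> I"
proof
  fix x assume "x \<in> mult_span A B"
  then show "x \<in> I"
    by induction (use assms left_ideal_zero left_ideal_add in blast)+
qed

lemma mult_span_subset_right: "left_ideal B \<Longrightarrow> mult_span A B \<subseteq> B"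
  by (rule mult_span_least) (auto intro: left_ideal_mult)

lemma mult_span_assoc_subset:
  assumes A: "left_ideal A"
  shows "mult_span A (mult_span B C) \<subseteq> mult_span (mult_span A B) C"
proof (rule mult_span_least)
  show l: "left_ideal (mult_span (mult_span A B) C)"
    by (intro left_ideal_mult_span A)
  fix a y assume a: "a \<in> A" and "y \<in> mult_span B C"
  from this(2) show "a * y \<in> mult_span (mult_span A B) C"
  proof induction
    case zero
    then show ?case by (simp add: mult_span.zero)
  next
    case (step y b c)
    then show ?case
      using mult_span.step[OF step.IH mult_span_base[OF a step.hyps(2)] step.hyps(3)]
      by (simp add: distrib_left mult.assoc)
  qed
qed

text \<open>With \<open>L'\<close> maximal among the left ideals between \<open>M * L\<close> and \<open>L\<close> that do not contain
  a given \<open>u\<close> in \<open>L\<close>, one has \<open>L = L' + Tu\<close>, and \<open>Tu\<close> modulo \<open>L'\<close> is a quotient of \<open>T/M\<close>.\<close>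
lemma small_quotient_descent:
  assumes "residue_division_ring M" and M: "small_quotient M" and L: "small_quotient L"
    and ne: "\<not> L \<subseteq> mult_span M L"
  shows "\<exists>L'. small_quotient L' \<and> L' \<subset> L"
proof -
  interpret residue_division_ring M by fact
  have l: "left_ideal L" using L by (simp add: small_quotient_def)
  obtain u where u: "u \<in> L" "u \<notin> mult_span M L" using ne by blast
  let ?A = "{I. left_ideal I \<and> mult_span M L \<subseteq> I \<and> I \<subseteq> L \<and> u \<notin> I}"
  have "\<exists>I\<in>?A. \<forall>J\<in>?A. I \<subseteq> J \<longrightarrow> J = I"
  proof (rule subset_Zorn_nonempty)
    have "mult_span M L \<in> ?A"
      using left_ideal_mult_span[OF left] mult_span_subset_right[OF l] u(2) by blast
    then show "?A \<noteq> {}" by blast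
    fix \<C> assume ne: "\<C> \<noteq> {}" and C: "subset.chain ?A \<C>"
    have CA: "\<C> \<subseteq> ?A" using C by (simp add: subset.chain_def)
    have "left_ideal (\<Union>\<C>)"
      by (rule left_ideal_Union_chain[OF ne C]) simp
    moreover have "mult_span M L \<subseteq> \<Union>\<C>" "\<Union>\<C> \<subseteq> L" "u \<notin> \<Union>\<C>"
      using ne CA by blast+
    ultimately show "\<Union>\<C> \<in> ?A" by blast
  qed
  then obtain L' where L': "L' \<in> ?A" and "\<forall>J\<in>?A. L' \<subseteq> J \<longrightarrow> J = L'" ..
  note max = this(2)[rule_format]
  have l': "left_ideal L'" using L' by blast
  have absorb: "m * v \<in> L'" if "m \<in> M" "v \<in> L" for m v
    using mult_span_base[OF that] L' by blast
  \<comment> \<open>For \<open>v\<close> outside \<open>L'\<close>, maximality puts \<open>u\<close>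
    into \<open>L' + T v\<close>, say \<open>u = i + r * v\<close>. Here \<open>r\<close> is not in
    \<open>M\<close>, as otherwise \<open>u\<close> would lie in \<open>L'\<close>; a left inverse
    of \<open>r\<close> modulo \<open>M\<close> then expresses \<open>v\<close> through
    \<open>u\<close>.\<close>
  have decompose: "\<exists>i r. i \<in> L' \<and> v = i + r * u" if v: "v \<in> L" for v
  proof (cases "v \<in> L'")
    case True
    then show ?thesis by (intro exI[of _ v] exI[of _ 0]) simp
  next
    case False
    let ?I = "{i + r * v |i r. i \<in> L' \<and> r \<in> UNIV}"
    have I: "left_ideal ?I" by (rule left_ideal_add_principal[OF l' left_ideal_UNIV])
    have LI: "L' \<subseteq> ?I" by (rule subset_add_principal[OF left_ideal_UNIV])
    have "v = 0 + 1 * v" by simp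
    then have vI: "v \<in> ?I" using left_ideal_zero[OF l'] by blast
    have IL: "?I \<subseteq> L"
    proof
      fix y assume "y \<in> ?I"
      then obtain i r where "y = i + r * v" "i \<in> L'" by blast
      then show "y \<in> L" using L' left_ideal_add[OF l _ left_ideal_mult[OF l v]] by blast
    qed
    have "u \<in> ?I"
    proof (rule ccontr)
      assume "u \<notin> ?I"
      moreover have "mult_span M L \<subseteq> ?I" using L' LI by blast
      ultimately have "?I \<in> ?A" using I IL by simp
      then have "?I = L'" using LI by (rule max)
      then show False using vI False by simp
    qed
    then obtain i r where ir: "u = i + r * v" "i \<in> L'" by blast
    have "r \<notin> M"
    proof
      assume "r \<in> M"
      then have "u \<in> L'" unfolding ir(1) by (intro left_ideal_add[OF l' ir(2)] absorb v)
      then show False using L' by blast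
    qed
    then obtain s where s: "s * r - 1 \<in> M" using left_inverse by blast
    have "v = - (s * i) - (s * r - 1) * v + s * u" by (simp add: ir(1) algebra_simps)
    moreover have "- (s * i) - (s * r - 1) * v \<in> L'"
      by (intro left_ideal_diff[OF l'] left_ideal_uminus[OF l'] left_ideal_mult[OF l'] ir(2) absorb s v)
    ultimately show ?thesis by blast
  qed
  have "\<exists>C. countable C \<and> (\<forall>t. \<exists>c\<in>C. t - c \<in> L')"
  proof -
    obtain C D where C: "countable C" "\<And>t. \<exists>c\<in>C. t - c \<in> L"
      and D: "countable D" "\<And>t. \<exists>d\<in>D. t - d \<in> M"
      using L M unfolding small_quotient_def by blast
    \<comment> \<open>A representative \<open>c\<close> modulo \<open>L\<close> leaves an error
      \<open>r * u\<close> modulo \<open>L'\<close>, and only the class of \<open>r\<close> modulo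
      \<open>M\<close> matters there.\<close>
    have "\<exists>e\<in>(\<lambda>(c, d). c + d * u) ` (C \<times> D). t - e \<in> L'" for t
    proof -
      obtain c where c: "c \<in> C" "t - c \<in> L" using C(2) by blast
      obtain i r where ir: "i \<in> L'" "t - c = i + r * u" using decompose[OF c(2)] by blast
      obtain d where d: "d \<in> D" "r - d \<in> M" using D(2) by blast
      have "t - (c + d * u) = (t - c) - d * u" by simp
      also have "\<dots> = i + (r - d) * u" unfolding ir(2) by (simp add: algebra_simps)
      also have "\<dots> \<in> L'" by (intro left_ideal_add[OF l' ir(1)] absorb d u)
      finally show ?thesis using c(1) d(1) by force
    qed
    moreover have "countable ((\<lambda>(c, d). c + d * u) ` (C \<times> D))" using C(1) D(1) by blast
    ultimately show ?thesis by blast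
  qed
  \<comment> \<open>Here and for the monic polynomials a product is taken: an element of
    \<open>M\<close> times an element of \<open>L\<close> lies in \<open>L'\<close>.\<close>
  moreover have "\<exists>n>0. of_nat n \<in> L'"
  proof -
    obtain m n :: nat where "m > 0" "of_nat m \<in> M" "n > 0" "of_nat n \<in> L"
      using L M unfolding small_quotient_def by blast
    then show ?thesis using absorb[of "of_nat m" "of_nat n"] by (intro exI[of _ "m * n"]) simp
  qed
  moreover have "\<exists>p. lead_coeff p = 1 \<and> int_poly_eval p t \<in> L'" for t
  proof -
    obtain p q where "lead_coeff p = 1" "int_poly_eval p t \<in> M" "lead_coeff q = 1" "int_poly_eval q t \<in> L"
      using L M unfolding small_quotient_def by blast
    then show ?thesis
      using absorb by (intro exI[of _ "p * q"]) (simp add: lead_coeff_mult int_poly_eval_mult)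
  qed
  ultimately have "small_quotient L'" using l' unfolding small_quotient_def by blast
  then show ?thesis using L' u(1) by blast
qed

text \<open>If \<open>L\<close> is nonzero, a left ideal \<open>K\<close> minimal with
  \<open>L\<close> contained in \<open>K L\<close> is idempotent and lies in every maximal left
  ideal. The argument for nilpotency of the Jacobson radical then gives a contradiction.\<close>

lemma left_ideal_fixed_by_maximal_ideals_eq_0:
  fixes L :: "'a::ring_1 set"
  assumes art: "left_artinian TYPE('a)" and L: "left_ideal L"
    and fixed: "\<And>M. maximal_left_ideal M \<Longrightarrow> L \<subseteq> mult_span M L"
    and two_sided: "\<And>(M :: 'a set) x y. maximal_left_ideal M \<Longrightarrow> x \<in> M \<Longrightarrow> x * y \<in> M"
  shows "L = {0}"
proof (rule ccontr)
  assume nz: "L \<noteq> {0}"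
  let ?X = "{K. left_ideal K \<and> L \<subseteq> mult_span K L}"
  have "x \<in> mult_span UNIV L" if "x \<in> L" for x
    using mult_span_base[of 1 UNIV x L] that by simp
  then have "UNIV \<in> ?X" using left_ideal_UNIV by blast
  then have "?X \<noteq> {}" by blast
  then obtain K where K: "K \<in> ?X" and "\<forall>J\<in>?X. J \<subseteq> K \<longrightarrow> J = K"
    using left_artinian_minimal[OF art, of ?X] by blast
  note min = this(2)[rule_format]
  have k: "left_ideal K" using K by blast
  have mono: "mult_span A L \<subseteq> mult_span A (mult_span K L)" if "left_ideal A" for A
    using K mult_span_base by (intro mult_span_least left_ideal_mult_span that) blast
  \<comment> \<open>\<open>(A K) L\<close> contains \<open>A (K L)\<close>, which contains
    \<open>A L\<close> and hence \<open>L\<close>. So \<open>A K\<close> competes with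
    \<open>K\<close>, and minimality gives equality.\<close>
  have fixedK: "mult_span A K = K" if A: "left_ideal A" "L \<subseteq> mult_span A L" for A
  proof (rule min)
    show "mult_span A K \<subseteq> K" by (rule mult_span_subset_right[OF k])
    show "mult_span A K \<in> ?X"
      using A(2) mono[OF A(1)] mult_span_assoc_subset[OF A(1), of K L] left_ideal_mult_span[OF A(1)]
      by blast
  qed
  have KK: "mult_span K K = K" using fixedK K by blast
  have KM: "K \<subseteq> M" if M: "maximal_left_ideal M" for M
  proof -
    note lM = maximal_left_idealD(1)[OF M]
    have "mult_span M K \<subseteq> M" by (rule mult_span_least[OF lM two_sided[OF M]])
    then show ?thesis using fixedK[OF lM fixed[OF M]] by simp
  qed
  \<comment> \<open>For \<open>I\<close> minimal with \<open>K I\<close> nonzero and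
    \<open>a * x\<close> nonzero, the left ideal \<open>K x\<close> equals \<open>I\<close>: since
    \<open>K K = K\<close>, also \<open>K (K x)\<close> is nonzero. Hence \<open>x = p * x\<close>
    for some \<open>p\<close> in \<open>K\<close>.\<close>
  let ?Y = "{I. left_ideal I \<and> (\<exists>k\<in>K. \<exists>i\<in>I. k * i \<noteq> 0)}"
  have "L \<in> ?Y"
  proof (rule ccontr)
    assume "L \<notin> ?Y"
    then have "\<forall>k\<in>K. \<forall>i\<in>L. k * i = 0" using L by blast
    then have "mult_span K L \<subseteq> {0}"
      by (intro mult_span_least) (auto simp: left_ideal_def)
    then show False using K nz left_ideal_zero[OF L] by blast
  qed
  then have "?Y \<noteq> {}" by blast
  then obtain I where I: "I \<in> ?Y" and "\<forall>J\<in>?Y. J \<subseteq> I \<longrightarrow> J = I"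
    using left_artinian_minimal[OF art, of ?Y] by blast
  note minI = this(2)[rule_format]
  obtain a x where ax: "a \<in> K" "x \<in> I" "a * x \<noteq> 0" using I by blast
  have l: "left_ideal I" using I by blast
  let ?Kx = "{i + j * x |i j. i \<in> {0} \<and> j \<in> K}"
  have Kx: "?Kx = I"
  proof (rule minI)
    have lKx: "left_ideal ?Kx"
      by (rule left_ideal_add_principal[OF _ k]) (simp add: left_ideal_def)
    moreover have "\<exists>k\<in>K. \<exists>i\<in>?Kx. k * i \<noteq> 0"
    proof (rule ccontr)
      assume "\<not> ?thesis"
      then have z: "b * (c * x) = 0" if "b \<in> K" "c \<in> K" for b c
        using that by force
      have "mult_span K K \<subseteq> {y. y * x = 0}"
        by (rule mult_span_least) (auto simp: left_ideal_def left_diff_distrib mult.assoc z)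
      then show False using KK ax by blast
    qed
    ultimately show "?Kx \<in> ?Y" by blast
    show "?Kx \<subseteq> I"
    proof
      fix y assume "y \<in> ?Kx"
      then obtain j where "y = j * x" by auto
      then show "y \<in> I" using left_ideal_mult[OF l ax(2)] by simp
    qed
  qed
  then have "x \<in> ?Kx" using ax(2) by simp
  then obtain p where p: "p \<in> K" "x = p * x" by auto
  \<comment> \<open>As \<open>p\<close> lies in every maximal left ideal, \<open>1 - p\<close> lies
    in none and has a left inverse \<open>j\<close>; then \<open>(1 - p) * x = 0\<close> forces
    \<open>x = 0\<close>.\<close>
  let ?J = "{i + j * (1 - p) |i j. i \<in> {0} \<and> j \<in> UNIV}"
  have J: "left_ideal ?J"
    by (rule left_ideal_add_principal[OF _ left_ideal_UNIV]) (simp add: left_ideal_def)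
  have "1 \<in> ?J"
  proof (rule ccontr)
    assume "1 \<notin> ?J"
    then obtain M where M: "maximal_left_ideal M" "?J \<subseteq> M"
      using maximal_left_ideal_exists[OF J] by blast
    have "1 - p = 0 + 1 * (1 - p)" by simp
    then have "1 - p \<in> M" using M(2) by blast
    moreover have "p \<in> M" using KM[OF M(1)] p(1) by blast
    ultimately have "(1 - p) + p \<in> M" by (rule left_ideal_add[OF maximal_left_idealD(1)[OF M(1)]])
    then show False using maximal_left_idealD(2)[OF M(1)] by simp
  qed
  then obtain j where j: "1 = j * (1 - p)" by auto
  have "x = j * (1 - p) * x" using j by simp
  also have "\<dots> = j * (x - p * x)" by (simp add: algebra_simps)
  also have "\<dots> = 0" using p(2) by simp
  finally show False using ax(3) by simp
qed

section \<open>Descent to a minimal left ideal with small quotient\<close>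

theorem theorem4p6:
  assumes "left_artinian TYPE('a::ring_1)"
    and "ring_integral_over (ring_center :: 'a set)"
  shows "has_maximal_subring TYPE('a) \<or>
    (countable (UNIV :: 'a set) \<and> nonzero_char TYPE('a) \<and>
     ring_integral_over (prime_subring :: 'a set))"
proof (cases "has_maximal_subring TYPE('a)")
  case False
  have two_sided: "x * y \<in> M" if "maximal_left_ideal M" "x \<in> M" for M and x y :: 'a
    using maximal_subring_if_maximal_left_ideal_not_two_sided[OF that(1) _ that(2)] False by blast
  have M: "residue_division_ring M" "small_quotient M" if M: "maximal_left_ideal M" for M :: "'a set"
  proof -
    interpret residue_division_ring M
      by (rule residue_division_ring_maximal[OF M two_sided[OF M]])
    show "residue_division_ring M" by unfold_locales
    interpret residue_field M
    proof
      show "x * y - y * x \<in> M" for x y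
        using maximal_subring_if_not_commutative[of x y] assms(2) False
        unfolding ring_integral_over_def by blast
    qed
    show "small_quotient M" by (rule small_quotient_residue_field[OF False])
  qed
  have "small_quotient (UNIV :: 'a set)"
    unfolding small_quotient_def
  proof (intro conjI allI)
    show "\<exists>C. countable C \<and> (\<forall>t. \<exists>c\<in>C. t - c \<in> (UNIV :: 'a set))"
      by (intro exI[of _ "{0}"]) simp
    show "\<exists>n>0. of_nat n \<in> (UNIV :: 'a set)" by (intro exI[of _ 1]) simp
    show "\<exists>p. lead_coeff p = 1 \<and> int_poly_eval p t \<in> UNIV" for t :: 'a
      by (intro exI[of _ 1]) simp
  qed (rule left_ideal_UNIV)
  then have "Collect small_quotient \<noteq> ({} :: 'a set set)" by blast
  then have "\<exists>L\<in>Collect small_quotient. \<forall>I\<in>Collect small_quotient. I \<subseteq> L \<longrightarrow> I = (L :: 'a set)"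
    by (rule left_artinian_minimal[OF assms(1)]) (simp add: small_quotient_def)
  then obtain L :: "'a set" where L: "small_quotient L"
    and min: "\<And>I. small_quotient I \<Longrightarrow> I \<subseteq> L \<Longrightarrow> I = L"
    by blast
  have "L = {0}"
  proof (rule left_ideal_fixed_by_maximal_ideals_eq_0[OF assms(1)])
    show "left_ideal L" using L by (simp add: small_quotient_def)
    \<comment> \<open>Otherwise \<open>small_quotient_descent\<close> would give a strictly smaller
      left ideal with small quotient, against minimality of \<open>L\<close>.\<close>
    show "L \<subseteq> mult_span M L" if "maximal_left_ideal M" for M
      using small_quotient_descent[OF M(1)[OF that] M(2)[OF that] L] min by blast
  qed (rule two_sided)
  then have zero: "small_quotient {0 :: 'a}" using L by simp
  obtain C :: "'a set" where C: "countable C" "\<And>t. \<exists>c\<in>C. t - c \<in> {0}"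
    using zero unfolding small_quotient_def by blast
  have "UNIV \<subseteq> C" using C(2) by force
  then have "countable (UNIV :: 'a set)" using C(1) by (rule countable_subset)
  moreover have "nonzero_char TYPE('a)"
    using zero unfolding small_quotient_def nonzero_char_def by blast
  moreover have "ring_integral_over (prime_subring :: 'a set)"
    using zero integral_over_prime_subring
    unfolding small_quotient_def ring_integral_over_def by blast
  ultimately show ?thesis by blast
qed blast

end
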